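(* For all integers $t\ge 3$, we have \[ \mathscr{I}(W_{2t+1}) \le \frac{4t^2 + 6t}{3(2t+2)^2}.\]
   Context: All graphs are finite and simple. $W_{n}$ denotes the $n$-wheel, the join of the cycle $C_{n}$ with a single vertex $K_1$ (so $W_{2t+1}$ has $2t+2$ vertices). The Cartesian product $G \Box H$ has vertex set $V(G)\times V(H)$, with $(u,x)$ adjacent to $(v,y)$ if and only if either $u=v$ and $xy\in E(H)$, or $x=y$ and $uv\in E(G)$. Set $G^{\Box 1}=G$ and $G^{\Box k}=G^{\Box (k-1)}\Box G$ for $k\ge 2$. $\alpha(G)$ is the independence number of $G$. The independence ratio is $i(G)=\alpha(G)/|V(G)|$, and the ultimate independence ratio is $\mathscr{I}(G)=\lim_{m\to\infty} i(G^{\Box m})$; this limit exists because $i(G^{\Box (m+1)})\le i(G^{\Box m})$ for all $m$. *)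

theory Defs
  imports Complex_Main "Graph_Theory.Pair_Digraph"
begin

text \<open>
  A finite simple graph is a \<^locale>\<open>pair_graph\<close>: a finite vertex set with a symmetric, irreflexive
  set of ordered pairs of vertices; an edge \<open>uv\<close> is represented by the two pairs
  \<open>(u, v)\<close> and \<open>(v, u)\<close>.
\<close>

definition cycle_graph :: "nat \<Rightarrow> nat pair_pre_digraph" where
  \<comment> \<open>the cycle \<open>C\<^sub>n\<close> for \<open>n \<ge> 3\<close>; not meaningful for smaller \<open>n\<close>\<close>
  "cycle_graph n = \<lparr> pverts = {..<n},
     parcs = {(u, v). u < n \<and> v < n \<and> (v = Suc u mod n \<or> u = Suc v mod n)} \<rparr>"

definition single_vertex :: "'a \<Rightarrow> 'a pair_pre_digraph" where
  "single_vertex v = \<lparr> pverts = {v}, parcs = {} \<rparr>"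

definition graph_join ::
  "'a pair_pre_digraph \<Rightarrow> 'b pair_pre_digraph \<Rightarrow> ('a + 'b) pair_pre_digraph" where
  "graph_join G H = \<lparr> pverts = pverts G <+> pverts H,
     parcs = {(Inl u, Inl v) | u v. (u, v) \<in> parcs G} \<union> {(Inr x, Inr y) | x y. (x, y) \<in> parcs H}
       \<union> {(Inl u, Inr x) | u x. u \<in> pverts G \<and> x \<in> pverts H}
       \<union> {(Inr x, Inl u) | u x. u \<in> pverts G \<and> x \<in> pverts H} \<rparr>"

definition wheel :: "nat \<Rightarrow> (nat + unit) pair_pre_digraph" where
  "wheel n = graph_join (cycle_graph n) (single_vertex ())"

definition cart_prod ::
  "'a pair_pre_digraph \<Rightarrow> 'b pair_pre_digraph \<Rightarrow> ('a \<times> 'b) pair_pre_digraph" where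
  "cart_prod G H = \<lparr> pverts = pverts G \<times> pverts H,
     parcs = {((u, x), (v, y)) | u v x y.
       (u = v \<and> u \<in> pverts G \<and> (x, y) \<in> parcs H) \<or> (x = y \<and> x \<in> pverts H \<and> (u, v) \<in> parcs G)} \<rparr>"

definition relabel :: "('a \<Rightarrow> 'b) \<Rightarrow> 'a pair_pre_digraph \<Rightarrow> 'b pair_pre_digraph" where
  "relabel f G = \<lparr> pverts = f ` pverts G, parcs = map_prod f f ` parcs G \<rparr>"

text \<open>
  The iterated products \<open>(\<dots>((G \<box> G) \<box> G) \<dots>) \<box> G\<close> have different vertex types, so the vertex
  \<open>((\<dots>(v\<^sub>1, v\<^sub>2), \<dots>), v\<^sub>k)\<close> of the \<open>k\<close>-th power is renamed, injectively, to the list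
  \<open>[v\<^sub>1, \<dots>, v\<^sub>k]\<close>. The zeroth power is the one-vertex graph; \<open>cart_power_1\<close> below states that the
  first power is \<open>G\<close> itself, up to this renaming.
\<close>

primrec cart_power :: "'a pair_pre_digraph \<Rightarrow> nat \<Rightarrow> 'a list pair_pre_digraph" where
  "cart_power G 0 = single_vertex []"
| "cart_power G (Suc k) = relabel (\<lambda>(vs, v). vs @ [v]) (cart_prod (cart_power G k) G)"

definition independent_set :: "'a pair_pre_digraph \<Rightarrow> 'a set \<Rightarrow> bool" where
  "independent_set G S \<longleftrightarrow> S \<subseteq> pverts G \<and> (\<forall>u\<in>S. \<forall>v\<in>S. (u, v) \<notin> parcs G)"

definition independence_number :: "'a pair_pre_digraph \<Rightarrow> nat" where
  "independence_number G = Max {card S | S. independent_set G S}"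

definition independence_ratio :: "'a pair_pre_digraph \<Rightarrow> real" where
  "independence_ratio G = real (independence_number G) / real (card (pverts G))"

text \<open>The limit exists for every finite simple graph: see
  \<open>independence_ratio_power_convergent\<close> below.\<close>

definition ultimate_independence_ratio :: "'a pair_pre_digraph \<Rightarrow> real" where
  "ultimate_independence_ratio G = lim (\<lambda>m. independence_ratio (cart_power G m))"

lemma cart_power_1:
  fixes G :: "'a pair_pre_digraph"
  assumes "pair_graph G"
  shows "cart_power G 1 = relabel (\<lambda>v. [v]) G"
proof -
  interpret pair_graph G by fact
  have "parcs (cart_prod (single_vertex ([] :: 'a list)) G) = (\<lambda>(x, y). (([], x), ([], y))) ` parcs G"
    by (auto simp: cart_prod_def single_vertex_def image_iff)
  moreover have "pverts (cart_prod (single_vertex ([] :: 'a list)) G) = Pair [] ` pverts G"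
    by (auto simp: cart_prod_def single_vertex_def)
  ultimately show ?thesis
    by (simp add: relabel_def image_image case_prod_beta map_prod_def)
qed

lemma pair_graphI:
  assumes "finite (pverts G)" "parcs G \<subseteq> pverts G \<times> pverts G" "sym (parcs G)"
    and "\<And>u. (u, u) \<notin> parcs G"
  shows "pair_graph G"
proof -
  have "finite (parcs G)"
    using assms(1,2) by (meson finite_SigmaI finite_subset)
  with assms show ?thesis
    by unfold_locales (auto simp: symmetric_def arcs_ends_def arc_to_ends_def with_proj_def)
qed

lemma pair_graphD:
  assumes "pair_graph G"
  shows "finite (pverts G)" "parcs G \<subseteq> pverts G \<times> pverts G" "sym (parcs G)" "(u, u) \<notin> parcs G"
proof -
  interpret pair_graph G by fact
  show "finite (pverts G)" by (rule pair_finite_verts)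
  show "sym (parcs G)" by (rule symI) (rule arcs_symmetric)
  show "parcs G \<subseteq> pverts G \<times> pverts G"
    using arc_fst_in_verts arc_snd_in_verts by force
  show "(u, u) \<notin> parcs G" using pair_no_loops[of "(u, u)"] by auto
qed

lemma pair_graph_cycle_graph:
  assumes "n \<ge> 3"
  shows "pair_graph (cycle_graph n)"
proof -
  have "(u, u) \<notin> parcs (cycle_graph n)" for u
    using assms by (cases "Suc u = n") (auto simp: cycle_graph_def)
  moreover have "sym (parcs (cycle_graph n))"
    by (rule symI) (simp add: cycle_graph_def disj_commute)
  ultimately show ?thesis
    by (intro pair_graphI) (auto simp: cycle_graph_def)
qed

lemma pair_graph_single_vertex: "pair_graph (single_vertex v)"
  by (intro pair_graphI) (auto simp: single_vertex_def sym_def)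

lemma pair_graph_graph_join:
  assumes "pair_graph G" "pair_graph H"
  shows "pair_graph (graph_join G H)"
  using pair_graphD[OF assms(1)] pair_graphD[OF assms(2)]
  by (intro pair_graphI) (auto simp: graph_join_def sym_def)

lemma pair_graph_wheel: "n \<ge> 3 \<Longrightarrow> pair_graph (wheel n)"
  by (simp add: wheel_def pair_graph_graph_join pair_graph_cycle_graph pair_graph_single_vertex)

lemma card_wheel: "card (pverts (wheel n)) = n + 1"
  by (simp add: wheel_def graph_join_def cycle_graph_def single_vertex_def card_Plus)

lemma pair_graph_cart_prod:
  assumes "pair_graph G" "pair_graph H"
  shows "pair_graph (cart_prod G H)"
  using pair_graphD[OF assms(1)] pair_graphD[OF assms(2)]
  by (intro pair_graphI) (auto simp: cart_prod_def sym_def)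

lemma pair_graph_relabel:
  assumes "pair_graph G" "inj f"
  shows "pair_graph (relabel f G)"
proof (rule pair_graphI)
  note G = pair_graphD[OF assms(1)]
  show "finite (pverts (relabel f G))" using G(1) by (simp add: relabel_def)
  show "parcs (relabel f G) \<subseteq> pverts (relabel f G) \<times> pverts (relabel f G)"
    using G(2) by (auto simp: relabel_def)
  show "sym (parcs (relabel f G))"
    using G(3) unfolding relabel_def by (auto intro!: symI dest: symD)
  show "(u, u) \<notin> parcs (relabel f G)" for u
    using G(4) assms(2) by (auto simp: relabel_def dest: injD)
qed

lemma inj_snoc: "inj (\<lambda>(vs, v). vs @ [v])"
  by (auto intro: injI)

lemma pair_graph_cart_power: "pair_graph G \<Longrightarrow> pair_graph (cart_power G k)"
  by (induction k)
    (simp_all add: pair_graph_single_vertex pair_graph_relabel pair_graph_cart_prod inj_snoc)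

lemma card_cart_power_Suc:
  "card (pverts (cart_power G (Suc k))) = card (pverts (cart_power G k)) * card (pverts G)"
  by (simp add: relabel_def card_image inj_on_subset[OF inj_snoc] cart_prod_def card_cartesian_product)

lemma
  assumes "finite (pverts G)"
  shows finite_independent_cards: "finite {card S | S. independent_set G S}"
    and independent_cards_nonempty: "{card S | S. independent_set G S} \<noteq> {}"
proof -
  have "{card S | S. independent_set G S} \<subseteq> card ` Pow (pverts G)"
    by (auto simp: independent_set_def)
  then show "finite {card S | S. independent_set G S}"
    using assms by (meson finite_Pow_iff finite_imageI finite_subset)
  have "independent_set G {}" by (simp add: independent_set_def)
  then show "{card S | S. independent_set G S} \<noteq> {}" by blast
qed

lemma card_le_independence_number:
  "finite (pverts G) \<Longrightarrow> independent_set G S \<Longrightarrow> card S \<le> independence_number G"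
  unfolding independence_number_def by (rule Max_ge[OF finite_independent_cards]) auto

lemma independence_number_leI:
  assumes "finite (pverts G)" "\<And>S. independent_set G S \<Longrightarrow> card S \<le> k"
  shows "independence_number G \<le> k"
  unfolding independence_number_def
  using finite_independent_cards[OF assms(1)] independent_cards_nonempty[OF assms(1)] assms(2)
  by (auto simp: Max_le_iff)

lemma independence_number_relabel_le:
  assumes "finite (pverts G)"
  shows "independence_number (relabel f G) \<le> independence_number G"
proof (rule independence_number_leI)
  show "finite (pverts (relabel f G))" using assms by (simp add: relabel_def)
  fix S assume S: "independent_set (relabel f G) S"
  define T where "T = {v \<in> pverts G. f v \<in> S}"
  have "independent_set G T"
    unfolding independent_set_def
  proof (intro conjI ballI notI)
    show "T \<subseteq> pverts G" by (auto simp: T_def)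
    fix u v assume "u \<in> T" "v \<in> T" "(u, v) \<in> parcs G"
    then have "f u \<in> S" "f v \<in> S" "(f u, f v) \<in> parcs (relabel f G)"
      by (auto simp: T_def relabel_def)
    with S show False by (auto simp: independent_set_def)
  qed
  then have "card T \<le> independence_number G"
    using assms by (rule card_le_independence_number[rotated])
  moreover have "S = f ` T"
    using S by (auto simp: independent_set_def T_def relabel_def)
  moreover have "finite T" using assms by (simp add: T_def)
  ultimately show "card S \<le> independence_number G"
    using card_image_le[of T f] by simp
qed

lemma independence_number_cart_prod_le:
  assumes "finite (pverts G)" "finite (pverts H)"
  shows "independence_number (cart_prod G H) \<le> independence_number G * card (pverts H)"
proof (rule independence_number_leI)
  show "finite (pverts (cart_prod G H))" using assms by (simp add: cart_prod_def)
  fix S assume S: "independent_set (cart_prod G H) S"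
  define F where "F x = {u. (u, x) \<in> S}" for x
  have "card (F x) \<le> independence_number G" if "x \<in> pverts H" for x
  proof (rule card_le_independence_number[OF assms(1)])
    show "independent_set G (F x)"
      unfolding independent_set_def
    proof (intro conjI ballI notI)
      show "F x \<subseteq> pverts G" using S by (auto simp: independent_set_def F_def cart_prod_def)
      fix u v assume "u \<in> F x" "v \<in> F x" "(u, v) \<in> parcs G"
      then have "(u, x) \<in> S" "(v, x) \<in> S" "((u, x), (v, x)) \<in> parcs (cart_prod G H)"
        using that by (auto simp: F_def cart_prod_def)
      with S show False by (auto simp: independent_set_def)
    qed
  qed
  then have "(\<Sum>x\<in>pverts H. card (F x)) \<le> card (pverts H) * independence_number G"
    using sum_bounded_above[of "pverts H" "\<lambda>x. card (F x)" "independence_number G"] by simp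
  moreover have "S = prod.swap ` Sigma (pverts H) F"
    using S by (auto simp: independent_set_def F_def cart_prod_def image_iff)
  moreover have "finite (F x)" if "x \<in> pverts H" for x
    by (rule finite_subset[OF _ assms(1)])
      (use S in \<open>auto simp: independent_set_def F_def cart_prod_def\<close>)
  ultimately show "card S \<le> independence_number G * card (pverts H)"
    using assms(2) by (simp add: card_image card_SigmaI mult.commute)
qed

lemma independence_ratio_cart_power_Suc_le:
  assumes "pair_graph G"
  shows "independence_ratio (cart_power G (Suc m)) \<le> independence_ratio (cart_power G m)"
proof -
  let ?P = "cart_power G m"
  have fin: "finite (pverts G)" "finite (pverts ?P)"
    using assms pair_graph_cart_power pair_graphD(1) by blast+
  have "independence_number (cart_power G (Suc m)) \<le> independence_number (cart_prod ?P G)"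
    using fin by (simp add: independence_number_relabel_le cart_prod_def)
  also have "\<dots> \<le> independence_number ?P * card (pverts G)"
    by (rule independence_number_cart_prod_le[OF fin(2,1)])
  finally have "real (independence_number (cart_power G (Suc m)))
      \<le> real (independence_number ?P) * real (card (pverts G))"
    using of_nat_mono by fastforce
  then have "independence_ratio (cart_power G (Suc m))
      \<le> real (independence_number ?P) * real (card (pverts G))
        / (real (card (pverts ?P)) * real (card (pverts G)))"
    unfolding independence_ratio_def card_cart_power_Suc of_nat_mult
    by (rule divide_right_mono) simp
  also have "\<dots> \<le> independence_ratio ?P"
    by (cases "card (pverts G) = 0") (auto simp: independence_ratio_def)
  finally show ?thesis .
qed

lemma independence_ratio_power_convergent:
  assumes "pair_graph G"
  shows "convergent (\<lambda>m. independence_ratio (cart_power G m))"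
proof -
  have "decseq (\<lambda>m. independence_ratio (cart_power G m))"
    using assms by (intro decseq_SucI independence_ratio_cart_power_Suc_le)
  moreover have "0 \<le> independence_ratio (cart_power G m)" for m
    by (simp add: independence_ratio_def)
  ultimately show ?thesis
    by (metis convergentI decseq_convergent)
qed

end

theory Submission
  imports Defs
begin

text \<open>
  For any nonnegative weights on the vertices of \<open>G\<^sup>k\<close>, the ultimate independence ratio of \<open>G\<close> is at
  most the largest weight of an independent set divided by the total weight. For \<open>t \<ge> 4\<close> it
  suffices to weight the square of the wheel: \<open>2\<close> if both or none of the coordinates are the hub and
  \<open>t + 1\<close> otherwise. Independent sets then weigh at most \<open>4t\<^sup>2 + 2t + 2\<close>, out of a total of
  \<open>12t\<^sup>2 + 14t + 6\<close>.

  For \<open>t = 3\<close> this is slightly too weak, and the same weights are used on the first two coordinates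
  of the cube. Each of the eight fibres over the third coordinate weighs at most 44, so that the
  claimed bound \<open>9/32 = 351/1248\<close> can only fail if all of them weigh exactly 44. The independent sets
  of weight 44 are rigid enough to exclude this.
\<close>

subsection \<open>Fractional bounds for the ultimate independence ratio\<close>

lemma pverts_cart_power: "pverts (cart_power G k) = {xs. length xs = k \<and> set xs \<subseteq> pverts G}"
proof (induction k)
  case 0
  then show ?case by (auto simp: single_vertex_def)
next
  case (Suc k)
  have "xs \<in> pverts (cart_power G (Suc k)) \<longleftrightarrow> length xs = Suc k \<and> set xs \<subseteq> pverts G" for xs
    by (cases xs rule: rev_cases) (auto simp: relabel_def cart_prod_def Suc image_iff)
  then show ?case by blast
qed

lemma card_pverts_cart_power: "card (pverts (cart_power G k)) = card (pverts G) ^ k"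
  by (induction k) (simp add: single_vertex_def, simp only: card_cart_power_Suc power_Suc2)

text \<open>With \<open>parcs_cart_powerE\<close> this describes the arcs of a power as changes of a
  single list entry along an arc of \<open>G\<close>. The induction runs from the right because
  \<open>cart_power\<close> appends the new coordinate at the end.\<close>

lemma parcs_cart_powerI:
  assumes "(u, v) \<in> parcs G" "set ps \<subseteq> pverts G" "set qs \<subseteq> pverts G"
  shows "(ps @ u # qs, ps @ v # qs) \<in> parcs (cart_power G (length ps + length qs + 1))"
  using assms(3)
proof (induction qs rule: rev_induct)
  case Nil
  show ?case
    by (auto simp: relabel_def cart_prod_def pverts_cart_power map_prod_def assms image_iff)
next
  case (snoc q qs)
  then have "(ps @ u # qs, ps @ v # qs) \<in> parcs (cart_power G (length ps + length qs + 1))" "q \<in> pverts G"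
    by auto
  then have "((ps @ u # qs, q), (ps @ v # qs, q))
      \<in> parcs (cart_prod (cart_power G (length ps + length qs + 1)) G)"
    by (simp add: cart_prod_def del: cart_power.simps)
  then have "map_prod (\<lambda>(vs, v). vs @ [v]) (\<lambda>(vs, v). vs @ [v]) ((ps @ u # qs, q), (ps @ v # qs, q))
      \<in> parcs (cart_power G (Suc (length ps + length qs + 1)))"
    unfolding cart_power.simps relabel_def by (simp del: cart_power.simps map_prod_simp)
  then show ?case by (simp del: cart_power.simps)
qed

lemma parcs_cart_powerE:
  assumes "(xs, ys) \<in> parcs (cart_power G k)"
  obtains ps u v qs where "xs = ps @ u # qs" "ys = ps @ v # qs" "(u, v) \<in> parcs G"
    "set ps \<subseteq> pverts G" "set qs \<subseteq> pverts G" "k = length ps + length qs + 1"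
proof -
  have "\<exists>ps u v qs. xs = ps @ u # qs \<and> ys = ps @ v # qs \<and> (u, v) \<in> parcs G \<and>
    set ps \<subseteq> pverts G \<and> set qs \<subseteq> pverts G \<and> k = length ps + length qs + 1"
    using assms
  proof (induction k arbitrary: xs ys)
    case 0
    then show ?case by (simp add: single_vertex_def)
  next
    case (Suc k)
    from Suc.prems obtain us u vs v where eq: "xs = us @ [u]" "ys = vs @ [v]" and
      "us = vs \<and> us \<in> pverts (cart_power G k) \<and> (u, v) \<in> parcs G \<or>
       u = v \<and> u \<in> pverts G \<and> (us, vs) \<in> parcs (cart_power G k)"
      by (auto simp: relabel_def cart_prod_def)
    then consider "us = vs" "us \<in> pverts (cart_power G k)" "(u, v) \<in> parcs G"
      | "u = v" "u \<in> pverts G" "(us, vs) \<in> parcs (cart_power G k)" by blast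
    then show ?case
    proof cases
      case 1
      then have "set us \<subseteq> pverts G" "length us = k" by (auto simp: pverts_cart_power)
      with 1 eq show ?thesis
        by (intro exI[of _ us] exI[of _ u] exI[of _ v] exI[of _ "[]"]) auto
    next
      case 2
      from Suc.IH[OF 2(3)] obtain ps a b qs where "us = ps @ a # qs" "vs = ps @ b # qs" "(a, b) \<in> parcs G"
        "set ps \<subseteq> pverts G" "set qs \<subseteq> pverts G" "k = length ps + length qs + 1" by blast
      with 2 eq show ?thesis
        by (intro exI[of _ ps] exI[of _ a] exI[of _ b] exI[of _ "qs @ [u]"]) auto
    qed
  qed
  then show ?thesis using that by blast
qed

text \<open>This and its left-hand counterpart make the fibres of an independent set of a power,
  over a fixed suffix or prefix, independent in the smaller power.\<close>

lemma parcs_cart_power_append_right: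
  assumes "(xs, ys) \<in> parcs (cart_power G m)" "us \<in> pverts (cart_power G k)"
  shows "(xs @ us, ys @ us) \<in> parcs (cart_power G (m + k))"
  using assms(1)
proof (rule parcs_cart_powerE)
  fix ps u v qs
  assume "xs = ps @ u # qs" "ys = ps @ v # qs" "(u, v) \<in> parcs G"
    "set ps \<subseteq> pverts G" "set qs \<subseteq> pverts G" "m = length ps + length qs + 1"
  then show ?thesis
    using assms(2) parcs_cart_powerI[of u v G ps "qs @ us"]
    by (simp add: pverts_cart_power add.assoc del: cart_power.simps)
qed

lemma parcs_cart_power_append_left:
  assumes "(us, vs) \<in> parcs (cart_power G k)" "xs \<in> pverts (cart_power G m)"
  shows "(xs @ us, xs @ vs) \<in> parcs (cart_power G (m + k))"
  using assms(1)
proof (rule parcs_cart_powerE)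
  fix ps u v qs
  assume "us = ps @ u # qs" "vs = ps @ v # qs" "(u, v) \<in> parcs G"
    "set ps \<subseteq> pverts G" "set qs \<subseteq> pverts G" "k = length ps + length qs + 1"
  then show ?thesis
    using assms(2) parcs_cart_powerI[of u v G "xs @ ps" qs] by (simp add: pverts_cart_power add.assoc del: cart_power.simps)
qed

lemma independence_number_attained:
  assumes "finite (pverts G)"
  obtains S where "independent_set G S" "card S = independence_number G"
proof -
  have "independence_number G \<in> {card S | S. independent_set G S}"
    unfolding independence_number_def
    by (rule Max_in[OF finite_independent_cards[OF assms] independent_cards_nonempty[OF assms]])
  then obtain S where "independence_number G = card S" "independent_set G S"
    by (elim CollectE exE conjE)
  then show ?thesis using that by simp
qed

text \<open>
  The fibre of a maximum independent set of \<open>G\<^bsup>m + k\<^esup>\<close> over a vertex of \<open>G\<^bsup>k\<^esup>\<close> has at most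
  \<open>\<alpha>(G\<^sup>m)\<close> elements, so no single fibre can be much smaller than the average once \<open>m\<close> is large.
  Hence the fibres may be averaged with respect to any weights.
\<close>

lemma weighted_independence_bound:
  fixes w :: "'a list \<Rightarrow> real"
  assumes G: "pair_graph G"
    and w: "\<And>u. u \<in> pverts (cart_power G k) \<Longrightarrow> 0 \<le> w u"
    and B: "\<And>S. independent_set (cart_power G k) S \<Longrightarrow> sum w S \<le> B"
  defines "N \<equiv> real (card (pverts G))"
  shows "sum w (pverts (cart_power G k)) *
      (N ^ k * real (independence_number (cart_power G (m + k)))
       - N ^ k * (N ^ k - 1) * real (independence_number (cart_power G m)))
    \<le> N ^ (m + k) * B"
proof -
  let ?V = "\<lambda>j. pverts (cart_power G j)" and ?\<alpha> = "\<lambda>j. independence_number (cart_power G j)"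
  have fin: "finite (?V j)" for j
    using G pair_graph_cart_power pair_graphD(1) by blast
  obtain S where S: "independent_set (cart_power G (m + k)) S" "card S = ?\<alpha> (m + k)"
    using independence_number_attained[OF fin] by blast
  define F where "F u = {x \<in> ?V m. x @ u \<in> S}" for u
  define E where "E x = {u \<in> ?V k. x @ u \<in> S}" for x
  have finF: "finite (F u)" for u using fin by (simp add: F_def)
  have F_le: "card (F u) \<le> ?\<alpha> m" if u: "u \<in> ?V k" for u
  proof (rule card_le_independence_number[OF fin])
    show "independent_set (cart_power G m) (F u)"
      using S(1) parcs_cart_power_append_right[OF _ u]
      unfolding independent_set_def F_def by blast
  qed
  have E_le: "sum w (E x) \<le> B" if x: "x \<in> ?V m" for x
  proof (rule B)
    show "independent_set (cart_power G k) (E x)"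
      using S(1) parcs_cart_power_append_left[OF _ x]
      unfolding independent_set_def E_def by blast
  qed
  have bij: "bij_betw (\<lambda>(u, x). x @ u) (Sigma (?V k) F) S"
  proof (rule bij_betw_byWitness[where f' = "\<lambda>y. (drop m y, take m y)"])
    show "(\<lambda>y. (drop m y, take m y)) ` S \<subseteq> Sigma (?V k) F"
    proof
      fix z assume "z \<in> (\<lambda>y. (drop m y, take m y)) ` S"
      then obtain y where y: "y \<in> S" "z = (drop m y, take m y)" by auto
      then have "length y = m + k" "set y \<subseteq> pverts G"
        using S(1) by (auto simp: independent_set_def pverts_cart_power)
      with y show "z \<in> Sigma (?V k) F"
        using set_take_subset[of m y] set_drop_subset[of m y] by (auto simp: pverts_cart_power F_def)
    qed
  qed (auto simp: F_def pverts_cart_power)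
  have sumF: "(\<Sum>u\<in>?V k. card (F u)) = ?\<alpha> (m + k)"
    using bij_betw_same_card[OF bij] S(2) fin finF by simp
  have cardV: "real (card (?V j)) = N ^ j" for j
    by (simp add: card_pverts_cart_power N_def)
  \<comment> \<open>All fibres other than the one over \<open>u\<close> have at most
    \<alpha>(\<open>m\<close>) elements, which leaves the rest of the total for
    \<open>F u\<close>.\<close>
  have F_ge: "real (?\<alpha> (m + k)) - (N ^ k - 1) * real (?\<alpha> m) \<le> real (card (F u))" if u: "u \<in> ?V k" for u
  proof -
    have "real (?\<alpha> (m + k)) = real (card (F u)) + (\<Sum>u'\<in>?V k - {u}. real (card (F u')))"
      unfolding sumF[symmetric] of_nat_sum using fin u by (rule sum.remove)
    also have "(\<Sum>u'\<in>?V k - {u}. real (card (F u'))) \<le> real (card (?V k - {u})) * real (?\<alpha> m)"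
      using F_le by (intro sum_bounded_above) auto
    also have "real (card (?V k - {u})) = N ^ k - 1"
      using card.remove[OF fin u] cardV[of k] by simp
    finally show ?thesis by simp
  qed
  \<comment> \<open>Double counting: weighting the fibres \<open>F u\<close> by \<open>w u\<close>
    amounts to summing the weights of the independent sets \<open>E x\<close>.\<close>
  have "sum w (?V k) * (real (?\<alpha> (m + k)) - (N ^ k - 1) * real (?\<alpha> m))
      \<le> (\<Sum>u\<in>?V k. w u * real (card (F u)))"
    unfolding sum_distrib_right using w F_ge by (intro sum_mono mult_left_mono) auto
  also have "\<dots> = (\<Sum>u\<in>?V k. \<Sum>x\<in>?V m. if x @ u \<in> S then w u else 0)"
    using fin by (intro sum.cong refl) (simp add: F_def mult.commute flip: sum.inter_filter)
  also have "\<dots> = (\<Sum>x\<in>?V m. sum w (E x))"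
    using fin by (subst sum.swap) (simp add: E_def flip: sum.inter_filter)
  also have "\<dots> \<le> real (card (?V m)) * B"
    using E_le by (intro sum_bounded_above) auto
  finally have "sum w (?V k) * (real (?\<alpha> (m + k)) - (N ^ k - 1) * real (?\<alpha> m)) \<le> N ^ m * B"
    by (simp add: cardV)
  \<comment> \<open>The factor \<open>N ^ k\<close> turns the right-hand side into a multiple of
    \<open>N ^ (m + k)\<close>, the number of vertices of the large power.\<close>
  then have "N ^ k * (sum w (?V k) * (real (?\<alpha> (m + k)) - (N ^ k - 1) * real (?\<alpha> m))) \<le> N ^ k * (N ^ m * B)"
    by (rule mult_left_mono) (simp add: N_def)
  then show ?thesis by (simp add: algebra_simps power_add)
qed

text \<open>Dividing the previous bound by \<open>N ^ (m + k)\<close> expresses it in independence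
  ratios. As \<open>m\<close> grows, the ratios of both powers tend to the same limit
  \<open>I\<close>, and \<open>N ^ k * I - (N ^ k - 1) * I = I\<close>.\<close>

lemma ultimate_independence_ratio_le_weighted:
  fixes w :: "'a list \<Rightarrow> real"
  assumes G: "pair_graph G" and ne: "pverts G \<noteq> {}"
    and w: "\<And>u. u \<in> pverts (cart_power G k) \<Longrightarrow> 0 \<le> w u"
    and B: "\<And>S. independent_set (cart_power G k) S \<Longrightarrow> sum w S \<le> B"
  shows "ultimate_independence_ratio G * sum w (pverts (cart_power G k)) \<le> B"
proof -
  let ?W = "sum w (pverts (cart_power G k))" and ?i = "\<lambda>m. independence_ratio (cart_power G m)"
  define N where "N = real (card (pverts G))"
  define I where "I = ultimate_independence_ratio G"
  have N: "N > 0" using ne pair_graphD(1)[OF G] by (simp add: N_def card_gt_0_iff)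
  have lim: "?i \<longlonglongrightarrow> I"
    unfolding I_def ultimate_independence_ratio_def
    using independence_ratio_power_convergent[OF G] by (simp add: convergent_LIMSEQ_iff)
  have "(\<lambda>m. ?W * (N ^ k * ?i (m + k) - (N ^ k - 1) * ?i m)) \<longlonglongrightarrow> ?W * (N ^ k * I - (N ^ k - 1) * I)"
    by (intro tendsto_intros lim LIMSEQ_ignore_initial_segment)
  moreover have "?W * (N ^ k * ?i (m + k) - (N ^ k - 1) * ?i m) \<le> B" for m
  proof -
    have "N ^ (m + k) * (?W * (N ^ k * ?i (m + k) - (N ^ k - 1) * ?i m))
        = ?W * (N ^ k * real (independence_number (cart_power G (m + k)))
           - N ^ k * (N ^ k - 1) * real (independence_number (cart_power G m)))"
      using N by (simp add: independence_ratio_def card_pverts_cart_power flip: N_def)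
        (simp add: field_simps power_add)
    also have "\<dots> \<le> N ^ (m + k) * B"
      unfolding N_def by (rule weighted_independence_bound[OF G w B])
    finally show ?thesis using N by (simp add: mult_le_cancel_left_pos)
  qed
  ultimately have "?W * (N ^ k * I - (N ^ k - 1) * I) \<le> B"
    by (intro LIMSEQ_le_const2) auto
  then show ?thesis by (simp add: I_def algebra_simps)
qed

subsection \<open>Independent sets in the square of a wheel\<close>

definition count_below :: "int \<Rightarrow> (int \<Rightarrow> bool) \<Rightarrow> int" where
  "count_below n P = (\<Sum>i\<in>{0..<n}. of_bool (P i))"

text \<open>
  A subset of the rim of \<open>W\<^sub>n\<close> is an \<open>n\<close>-periodic predicate on the integers, and \<open>h\<close> says
  whether the hub is selected. In a square, \<open>R\<close> holds the selected vertices (rim, hub), \<open>C\<close>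
  those of the form (hub, rim) and \<open>M\<close> those of the form (rim, rim).
\<close>

definition wheel_independent :: "int \<Rightarrow> bool \<Rightarrow> (int \<Rightarrow> bool) \<Rightarrow> bool" where
  "wheel_independent n h P \<longleftrightarrow>
     (\<forall>i. P (i + n) = P i) \<and> (\<forall>i. P i \<longrightarrow> \<not> P (i + 1)) \<and> (h \<longrightarrow> (\<forall>i. \<not> P i))"

definition wheel_square_independent ::
  "int \<Rightarrow> bool \<Rightarrow> (int \<Rightarrow> bool) \<Rightarrow> (int \<Rightarrow> bool) \<Rightarrow> (int \<Rightarrow> int \<Rightarrow> bool) \<Rightarrow> bool" where
  "wheel_square_independent n h R C M \<longleftrightarrow>
     wheel_independent n h R \<and> wheel_independent n h C \<and>
     (\<forall>r. wheel_independent n (R r) (M r)) \<and> (\<forall>c. wheel_independent n (C c) (\<lambda>r. M r c))"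

section \<open>Periodic functions and counting on an odd rim\<close>

lemma periodic_add_mult:
  fixes f :: "int \<Rightarrow> 'a"
  assumes "\<And>i. f (i + n) = f i"
  shows "f (i + k * n) = f i"
proof -
  have f_add: "f (i + int k * n) = f i" for i k
  proof (induction k)
    case (Suc k)
    have "i + int (Suc k) * n = (i + int k * n) + n" by (simp add: algebra_simps)
    then show ?case using assms Suc by metis
  qed simp
  show ?thesis
  proof (cases "k \<ge> 0")
    case True
    then show ?thesis using f_add[of i "nat k"] by simp
  next
    case False
    then show ?thesis using f_add[of "i + k * n" "nat (- k)"] by simp
  qed
qed

lemma periodic_mod:
  fixes f :: "int \<Rightarrow> 'a"
  assumes "\<And>i. f (i + n) = f i"
  shows "f (i mod n) = f i"
  using periodic_add_mult[of f n "i mod n" "i div n"] assms by simp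

lemma sum_periodic_shift:
  fixes f :: "int \<Rightarrow> 'a::comm_monoid_add"
  assumes "\<And>i. f (i + n) = f i"
  shows "sum f {a..<a + n} = sum f {0..<n}"
proof (cases "n > 0")
  case True
  have "a + (i mod n - a) mod n = i" if "i \<in> {a..<a + n}" for i
  proof -
    have "(i mod n - a) mod n = (i - a) mod n" by (rule mod_diff_left_eq)
    also have "\<dots> = i - a" using that by (intro mod_pos_pos_trivial) auto
    finally show ?thesis by simp
  qed
  moreover have "(a + (i - a) mod n) mod n = i" if "i \<in> {0..<n}" for i
  proof -
    have "(a + (i - a) mod n) mod n = (a + (i - a)) mod n" by (rule mod_add_right_eq)
    also have "\<dots> = i" using that by simp
    finally show ?thesis .
  qed
  moreover have "i mod n \<in> {0..<n}" "a + (i - a) mod n \<in> {a..<a + n}" for i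
    using True by simp_all
  moreover have "f (i mod n) = f i" for i
    using assms by (rule periodic_mod)
  ultimately show ?thesis
    by (intro sum.reindex_bij_witness[where i = "\<lambda>i. a + (i - a) mod n" and j = "\<lambda>i. i mod n"])
qed auto

text \<open>Cuts an odd period into \<open>t\<close> adjacent pairs and one leftover point, which
  can be placed where the summand is known.\<close>

lemma sum_odd_interval_pairs:
  fixes f :: "int \<Rightarrow> 'a::comm_monoid_add"
  shows "sum f {a..<a + (2 * int t + 1)}
    = (\<Sum>j<t. f (a + 2 * int j) + f (a + 2 * int j + 1)) + f (a + 2 * int t)"
proof (induction t)
  case 0
  have "{a..<a + 1} = {a}" by auto
  then show ?case by simp
next
  case (Suc t)
  have "{a..<a + (2 * int (Suc t) + 1)}
      = insert (a + 2 * int t + 2) (insert (a + 2 * int t + 1) {a..<a + (2 * int t + 1)})"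
    by auto
  then have "sum f {a..<a + (2 * int (Suc t) + 1)}
      = f (a + 2 * int t + 2) + (f (a + 2 * int t + 1) + sum f {a..<a + (2 * int t + 1)})"
    by simp
  then show ?case unfolding Suc by (simp add: ac_simps)
qed

lemma count_below_nonneg: "0 \<le> count_below n P"
  by (simp add: count_below_def sum_nonneg)

lemma count_below_disjoint:
  assumes "n \<ge> 0" "\<And>i. P i \<Longrightarrow> \<not> Q i"
  shows "count_below n P + count_below n Q \<le> n"
proof -
  have "count_below n P + count_below n Q = (\<Sum>i\<in>{0..<n}. of_bool (P i) + of_bool (Q i))"
    by (simp add: count_below_def sum.distrib)
  also have "\<dots> \<le> of_nat (card {0..<n}) * 1"
    using assms(2) by (intro sum_bounded_above) (auto simp: of_bool_def)
  finally show ?thesis using assms(1) by simp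
qed

lemma count_below_eq_0: "count_below n P = 0 \<longleftrightarrow> (\<forall>i\<in>{0..<n}. \<not> P i)"
  unfolding count_below_def by (subst sum_nonneg_eq_0_iff) auto

lemma count_below_pos_iff: "0 < count_below n P \<longleftrightarrow> (\<exists>i\<in>{0..<n}. P i)"
  using count_below_eq_0[of n P] count_below_nonneg[of n P] by auto

text \<open>An independent set and its shift by one are disjoint and equally large within a period
  of length \<open>2t + 1\<close>, so integrality leaves at most \<open>t\<close> elements. A
  selected hub empties the rim, whence the factor.\<close>

lemma count_below_independent:
  assumes "wheel_independent (2 * int t + 1) h P"
  shows "count_below (2 * int t + 1) P \<le> int t * (1 - of_bool h)"
proof (cases h)
  case True
  then show ?thesis using assms by (auto simp: wheel_independent_def count_below_def)
next
  case False
  let ?n = "2 * int t + 1"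
  have "count_below ?n P = count_below ?n (\<lambda>i. P (i + 1))"
  proof -
    have "count_below ?n P = (\<Sum>i\<in>{1..<1 + ?n}. of_bool (P i))"
      unfolding count_below_def using assms
      by (subst sum_periodic_shift) (auto simp: wheel_independent_def)
    also have "\<dots> = count_below ?n (\<lambda>i. P (i + 1))"
      unfolding count_below_def
      by (rule sum.reindex_bij_witness[where i = "\<lambda>i. i + 1" and j = "\<lambda>i. i - 1"]) auto
    finally show ?thesis .
  qed
  moreover have "count_below ?n P + count_below ?n (\<lambda>i. P (i + 1)) \<le> ?n"
    using assms by (intro count_below_disjoint) (auto simp: wheel_independent_def)
  ultimately show ?thesis using False by simp
qed

section \<open>Weighted count in the square\<close>

lemma wheel_square_independent_transpose:
  "wheel_square_independent n h R C M \<Longrightarrow> wheel_square_independent n h C R (\<lambda>c r. M r c)"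
  by (auto simp: wheel_square_independent_def)

lemma sum_count_below_transpose:
  "(\<Sum>c\<in>{0..<n}. count_below n (\<lambda>r. M r c)) = (\<Sum>r\<in>{0..<n}. count_below n (M r))"
  unfolding count_below_def by (rule sum.swap)

text \<open>Rows in \<open>R\<close> are empty and every other row holds at most \<open>t\<close>
  vertices.\<close>

lemma grid_count_le:
  assumes ind: "wheel_square_independent n h R C M" and n: "n = 2 * int t + 1"
  shows "(\<Sum>r\<in>{0..<n}. count_below n (M r)) \<le> int t * (n - count_below n R)"
proof -
  have "(\<Sum>r\<in>{0..<n}. count_below n (M r)) \<le> (\<Sum>r\<in>{0..<n}. int t * (1 - of_bool (R r)))"
    using ind unfolding n wheel_square_independent_def
    by (intro sum_mono count_below_independent) auto
  also have "\<dots> = int t * (n - count_below n R)"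
    using n by (simp add: count_below_def sum_subtractf flip: sum_distrib_left)
  finally show ?thesis .
qed

text \<open>
  Two adjacent rows have disjoint traces, which avoid the columns in \<open>C\<close>. Starting after a row in
  \<open>R\<close>, the other \<open>2t\<close> rows split into \<open>t\<close> adjacent pairs, and \<open>R\<close> meets all but
  \<open>t + 1 - \<bar>R\<bar>\<close> of them.
\<close>

lemma grid_count_le_pairs:
  assumes ind: "wheel_square_independent n h R C M" and n: "n = 2 * int t + 1"
    and R: "count_below n R > 0"
  shows "(\<Sum>r\<in>{0..<n}. count_below n (M r))
    \<le> (int t + 1 - count_below n R) * (n - count_below n C) + (count_below n R - 1) * int t"
proof -
  let ?k = "count_below n C" and ?l = "count_below n R" and ?f = "\<lambda>r. count_below n (M r)"
  let ?b = "\<lambda>r. of_bool (R r) :: int"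
  have per: "R (r + n) = R r" "M (r + n) c = M r c" for r c
    using ind by (auto simp: wheel_square_independent_def wheel_independent_def)
  have adj: "M r c \<Longrightarrow> \<not> M (r + 1) c" "R r \<Longrightarrow> \<not> R (r + 1)" "C c \<Longrightarrow> \<not> M r c" for r c
    using ind by (auto simp: wheel_square_independent_def wheel_independent_def)
  have row: "?f r \<le> int t * (1 - ?b r)" for r
    unfolding n by (rule count_below_independent) (use ind in \<open>simp add: wheel_square_independent_def n\<close>)
  obtain r0 where r0: "R r0" using R by (auto simp: count_below_pos_iff)
  \<comment> \<open>With this start, the point left over from the pairing is a periodic copy of
    \<open>r0\<close>, whose row is empty.\<close>
  define a where "a = r0 + 1"
  have last: "a + 2 * int t = r0 + n" by (simp add: a_def n)
  define p where "p j = ?b (a + 2 * int j) + ?b (a + 2 * int j + 1)" for j :: nat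
  have m: "sum ?f {0..<n} = (\<Sum>j<t. ?f (a + 2 * int j) + ?f (a + 2 * int j + 1))"
  proof -
    have "sum ?f {0..<n} = sum ?f {a..<a + n}"
      by (rule sum_periodic_shift[symmetric]) (simp add: per count_below_def)
    also have "\<dots> = (\<Sum>j<t. ?f (a + 2 * int j) + ?f (a + 2 * int j + 1)) + ?f (a + 2 * int t)"
      unfolding n by (rule sum_odd_interval_pairs)
    also have "?f (a + 2 * int t) = 0"
      unfolding last using row[of r0] r0 count_below_nonneg[of n "M r0"] by (simp add: per count_below_def)
    finally show ?thesis by simp
  qed
  have l: "?l = (\<Sum>j<t. p j) + 1"
  proof -
    have "?l = sum ?b {a..<a + n}"
      unfolding count_below_def by (rule sum_periodic_shift[symmetric]) (simp add: per)
    also have "\<dots> = (\<Sum>j<t. p j) + ?b (a + 2 * int t)"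
      unfolding n p_def by (rule sum_odd_interval_pairs)
    also have "?b (a + 2 * int t) = 1" unfolding last by (simp add: per r0)
    finally show ?thesis .
  qed
  \<comment> \<open>At most one of two adjacent rows is in \<open>R\<close>. If one is, it is empty
    and the other has at most \<open>t\<close> vertices; if none is, the two traces and
    \<open>C\<close> are disjoint within one period.\<close>
  have pair: "?f r + ?f (r + 1) \<le> (1 - (?b r + ?b (r + 1))) * (n - ?k) + (?b r + ?b (r + 1)) * int t" for r
  proof -
    consider "R r" "\<not> R (r + 1)" | "\<not> R r" "R (r + 1)" | "\<not> R r" "\<not> R (r + 1)" using adj(2) by blast
    then show ?thesis
    proof cases
      case 3
      have "?f r + ?f (r + 1) + ?k = (\<Sum>c\<in>{0..<n}. of_bool (M r c) + of_bool (M (r + 1) c) + of_bool (C c))"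
        by (simp add: count_below_def sum.distrib)
      also have "\<dots> \<le> of_nat (card {0..<n}) * 1"
        by (intro sum_bounded_above) (auto simp: of_bool_def dest: adj)
      finally show ?thesis using 3 n by simp
    qed (use row[of r] row[of "r + 1"] in auto)
  qed
  have "sum ?f {0..<n} \<le> (\<Sum>j<t. (1 - p j) * (n - ?k) + p j * int t)"
    unfolding m p_def by (intro sum_mono pair)
  also have "\<dots> = (int t - (\<Sum>j<t. p j)) * (n - ?k) + (\<Sum>j<t. p j) * int t"
    by (simp add: sum.distrib sum_subtractf flip: sum_distrib_right)
  finally show ?thesis by (simp add: l)
qed

text \<open>A selected hub forces \<open>k = l = 0\<close>. Without it, if \<open>k\<close> or
  \<open>l\<close> vanishes, the row or column count already keeps the weight below the maximum.
  Otherwise the pair count leaves a deficit that vanishes only for \<open>k = l = 1\<close> and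
  \<open>k = l = t\<close>.\<close>

lemma wheel_square_weight:
  assumes ind: "wheel_square_independent n h R C M" and n: "n = 2 * int t + 1" and t: "t \<ge> 2"
  defines "k \<equiv> count_below n C" and "l \<equiv> count_below n R" and "m \<equiv> \<Sum>r\<in>{0..<n}. count_below n (M r)"
  defines "\<Phi> \<equiv> 2 * of_bool h + (int t + 1) * (k + l) + 2 * m"
  shows "\<Phi> \<le> 2 * int t * n + 2"
    and "\<Phi> = 2 * int t * n + 2 \<Longrightarrow>
      h \<and> k = 0 \<and> l = 0 \<or> \<not> h \<and> k = 1 \<and> l = 1 \<or> \<not> h \<and> k = int t \<and> l = int t"
proof -
  have "wheel_independent (2 * int t + 1) h R" "wheel_independent (2 * int t + 1) h C"
    using ind by (simp_all add: wheel_square_independent_def n)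
  from this[THEN count_below_independent]
  have kl: "0 \<le> k" "k \<le> int t * (1 - of_bool h)" "0 \<le> l" "l \<le> int t * (1 - of_bool h)"
    by (simp_all add: k_def l_def n count_below_nonneg)
  have ml: "m \<le> int t * (n - l)" unfolding m_def l_def by (rule grid_count_le[OF ind n])
  have mk: "m \<le> int t * (n - k)"
    unfolding m_def k_def
    by (subst sum_count_below_transpose[symmetric])
      (rule grid_count_le[OF wheel_square_independent_transpose[OF ind] n])
  have "\<Phi> \<le> 2 * int t * n + 2 \<and> (\<Phi> = 2 * int t * n + 2 \<longrightarrow>
      h \<and> k = 0 \<and> l = 0 \<or> \<not> h \<and> k = 1 \<and> l = 1 \<or> \<not> h \<and> k = int t \<and> l = int t)"
  proof (cases h)
    case True
    then have "k = 0" "l = 0" using kl by auto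
    then show ?thesis using True ml by (simp add: \<Phi>_def)
  next
    case False
    show ?thesis
    proof (cases "k = 0 \<or> l = 0")
      case True
      \<comment> \<open>One summand is zero, so \<open>j\<close> is the other one and a single
        estimate covers both cases.\<close>
      define j where "j = k + l"
      have j: "0 \<le> j" "m \<le> int t * (n - j)" using True kl ml mk by (auto simp: j_def)
      have "\<Phi> \<le> 2 * int t * n - (int t - 1) * j"
        using j(2) False by (simp add: \<Phi>_def algebra_simps flip: j_def)
      moreover have "(int t - 1) * j \<ge> 0" using j(1) t by simp
      ultimately show ?thesis by linarith
    next
      case nonzero: False
      then have pos: "k \<ge> 1" "l \<ge> 1" "k \<le> int t" "l \<le> int t" using kl False by auto
      have "m \<le> (int t + 1 - l) * (n - k) + (l - 1) * int t"
        using grid_count_le_pairs[OF ind n] pos(2) unfolding m_def l_def k_def by simp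
      then have le: "\<Phi> \<le> 2 * int t * n + 2 - ((k - 1) * (int t - l) + (l - 1) * (int t - k))"
        using False by (simp add: \<Phi>_def n algebra_simps)
      have nonneg: "(k - 1) * (int t - l) \<ge> 0" "(l - 1) * (int t - k) \<ge> 0" using pos by auto
      \<comment> \<open>Both products in the deficit must vanish; since \<open>1\<close> and
        \<open>t\<close> differ, the mixed solutions are impossible.\<close>
      have "k = 1 \<and> l = 1 \<or> k = int t \<and> l = int t" if "\<Phi> = 2 * int t * n + 2"
      proof -
        have "(k - 1) * (int t - l) = 0" "(l - 1) * (int t - k) = 0" using that le nonneg by linarith+
        then show ?thesis using t by auto
      qed
      moreover have "\<Phi> \<le> 2 * int t * n + 2" using le nonneg by linarith
      ultimately show ?thesis using False by blast
    qed
  qed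
  then show "\<Phi> \<le> 2 * int t * n + 2"
    and "\<Phi> = 2 * int t * n + 2 \<Longrightarrow>
      h \<and> k = 0 \<and> l = 0 \<or> \<not> h \<and> k = 1 \<and> l = 1 \<or> \<not> h \<and> k = int t \<and> l = int t" by auto
qed

subsection \<open>Extremal configurations in the cube of the 7-wheel\<close>

lemma atLeastLessThan_7: "{a..<a + 7 :: int} = {a, a + 1, a + 2, a + 3, a + 4, a + 5, a + 6}"
  by auto

lemma count_below_7:
  assumes "\<And>i. P (i + 7) = P i"
  shows "count_below 7 P = of_bool (P a) + of_bool (P (a + 1)) + of_bool (P (a + 2)) + of_bool (P (a + 3))
    + of_bool (P (a + 4)) + of_bool (P (a + 5)) + of_bool (P (a + 6))"
proof -
  have "count_below 7 P = (\<Sum>i\<in>{a..<a + 7}. of_bool (P i))"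
    unfolding count_below_def by (rule sum_periodic_shift[symmetric]) (simp add: assms)
  then show ?thesis by (simp add: atLeastLessThan_7)
qed

lemma wheel_independentD:
  assumes "wheel_independent n h P"
  shows "P (i + n) = P i" "P i \<Longrightarrow> \<not> P (i + 1)" "h \<Longrightarrow> \<not> P i"
  using assms by (auto simp: wheel_independent_def)

text \<open>The rotations of {0, 2, 4} modulo 7, which are all the three-element independent sets of
  the 7-cycle.\<close>

definition heptagon_triple :: "int \<Rightarrow> int \<Rightarrow> bool" where
  "heptagon_triple x c \<longleftrightarrow> (c - x) mod 7 \<in> {0, 2, 4}"

lemma heptagon_triple_cong:
  assumes "7 dvd x - y"
  shows "heptagon_triple x = heptagon_triple y"
proof
  fix c
  have "7 dvd (c - y) - (c - x)" using assms by simp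
  then have "(c - x) mod 7 = (c - y) mod 7" by (simp only: mod_eq_dvd_iff dvd_diff_commute)
  then show "heptagon_triple x c = heptagon_triple y c" by (simp add: heptagon_triple_def)
qed

lemma residue_7_cases:
  obtains "(a :: int) mod 7 = 0" | "a mod 7 = 1" | "a mod 7 = 2" | "a mod 7 = 3"
    | "a mod 7 = 4" | "a mod 7 = 5" | "a mod 7 = 6"
proof -
  have "0 \<le> a mod 7" "a mod 7 < 7" by simp_all
  then show ?thesis using that by linarith
qed

text \<open>The cyclic gaps between three pairwise nonadjacent points are at least 2 and add up to
  7, so they are 2, 2 and 3. The witness \<open>x\<close> is the point after the long gap.\<close>

lemma independent_heptagon_triple:
  assumes ind: "wheel_independent 7 h P" and card: "count_below 7 P = 3"
  obtains x where "P = heptagon_triple x"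
proof -
  note per = wheel_independentD(1)[OF ind] and adj = wheel_independentD(2)[OF ind]
  have adj': "\<not> P i \<or> \<not> P (i + 1)" for i using adj[of i] by blast
  have "\<exists>x. P x \<and> P (x + 2) \<and> P (x + 4)"
  proof -
    have sum: "of_bool (P 0) + of_bool (P 1) + of_bool (P 2) + of_bool (P 3)
        + of_bool (P 4) + of_bool (P 5) + of_bool (P 6) = (3 :: int)"
      using count_below_7[of P 0, OF per] card by simp
    have wrap: "P 7 = P 0" "P 8 = P 1" "P 9 = P 2" "P 10 = P 3"
      using per[of 0] per[of 1] per[of 2] per[of 3] by simp_all
    have "P 0 \<and> P 2 \<and> P 4 \<or> P 1 \<and> P 3 \<and> P 5 \<or> P 2 \<and> P 4 \<and> P 6 \<or> P 3 \<and> P 5 \<and> P 7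
        \<or> P 4 \<and> P 6 \<and> P 8 \<or> P 5 \<and> P 7 \<and> P 9 \<or> P 6 \<and> P 8 \<and> P 10"
      using sum adj'[of 0] adj'[of 1] adj'[of 2] adj'[of 3] adj'[of 4] adj'[of 5] adj'[of 6]
      by (auto simp: wrap of_bool_def split: if_splits)
    then show ?thesis
      by (elim disjE) (rule exI[of _ 0] exI[of _ 1] exI[of _ 2] exI[of _ 3] exI[of _ 4] exI[of _ 5] exI[of _ 6],
        simp)+
  qed
  then obtain x where x: "P x" "P (x + 2)" "P (x + 4)" by blast
  have "\<not> P (x + 1)" "\<not> P (x + 3)" "\<not> P (x + 5)" "\<not> P (x + 6)"
    using adj'[of x] adj'[of "x + 2"] adj'[of "x + 4"] adj'[of "x + 6"] x per[of x] by (auto simp: add.assoc)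
  moreover have "P c = P (x + (c - x) mod 7)" for c
  proof -
    have "P c = P (x + (c - x) mod 7 + (c - x) div 7 * 7)" by (simp add: add.assoc)
    also have "\<dots> = P (x + (c - x) mod 7)" by (rule periodic_add_mult) (rule per)
    finally show ?thesis .
  qed
  moreover have "d \<in> {0, 1, 2, 3, 4, 5, 6}" if "d = e mod 7" for d e :: int
    using that by auto
  ultimately have "P c = heptagon_triple x c" for c
    using x unfolding heptagon_triple_def by (metis (no_types, lifting) add_0_right empty_iff insert_iff)
  then show ?thesis using that by blast
qed

text \<open>The complement {1, 3, 5, 6} of the triple {0, 2, 4} contains only the triples {1, 3, 5}
  and {6, 1, 3}, which start at 1 and 6.\<close>

lemma heptagon_triple_disjoint:
  assumes "\<And>c. heptagon_triple x c \<Longrightarrow> \<not> heptagon_triple y c"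
  shows "(y - x) mod 7 = 1 \<or> (y - x) mod 7 = 6"
proof -
  have "(x + j - y) mod 7 = (j - (y - x) mod 7) mod 7" for j
    by (simp add: mod_diff_right_eq algebra_simps)
  then have iff: "heptagon_triple y (x + j) \<longleftrightarrow> (j - (y - x) mod 7) mod 7 \<in> {0, 2, 4}" for j
    by (simp add: heptagon_triple_def)
  have "\<not> heptagon_triple y (x + 0)" "\<not> heptagon_triple y (x + 2)" "\<not> heptagon_triple y (x + 4)"
    using assms[of "x + 0"] assms[of "x + 2"] assms[of "x + 4"] by (auto simp: heptagon_triple_def)
  then show ?thesis
    unfolding iff by (cases "y - x" rule: residue_7_cases) simp_all
qed

text \<open>
  Consecutive triples differ by a rotation by \<open>\<plusminus>1\<close>, and seven odd steps that add up to a multiple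
  of 7 must all be equal.
\<close>

lemma heptagon_triples_rotate:
  assumes per: "\<And>i. X (i + 7) = X i"
    and ind: "\<And>i. wheel_independent 7 (h i) (X i)" and card: "\<And>i. count_below 7 (X i) = 3"
    and disj: "\<And>i c. X i c \<Longrightarrow> \<not> X (i + 1) c"
  obtains \<delta> x :: int where "\<delta> = 1 \<or> \<delta> = -1" "\<And>i. X i = heptagon_triple (\<delta> * i + x)"
proof -
  have "\<exists>x. X i = heptagon_triple x" for i
    using independent_heptagon_triple[OF ind card] by blast
  then obtain \<xi> where \<xi>: "\<And>i. X i = heptagon_triple (\<xi> i)" by metis
  \<comment> \<open>By disjointness the only difference other than 1 is 6, which is -1 modulo
    7.\<close>
  define e where "e i = (if (\<xi> (i + 1) - \<xi> i) mod 7 = 1 then 1 else - 1 :: int)" for i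
  have step: "7 dvd \<xi> (i + 1) - \<xi> i - e i" for i
  proof -
    have "(\<xi> (i + 1) - \<xi> i) mod 7 = 1 \<or> (\<xi> (i + 1) - \<xi> i) mod 7 = 6"
      using disj[of i] unfolding \<xi> by (rule heptagon_triple_disjoint)
    then have "((\<xi> (i + 1) - \<xi> i) mod 7 - e i) mod 7 = 0" by (auto simp: e_def)
    then show ?thesis by (simp only: mod_diff_left_eq mod_eq_0_iff_dvd)
  qed
  \<comment> \<open>Equal triples contain each other's starting points, so the difference and its
    negative both lie in {0, 2, 4} modulo 7; only 0 qualifies.\<close>
  have wrap: "7 dvd \<xi> (i + 7) - \<xi> i" for i
  proof -
    have "heptagon_triple (\<xi> (i + 7)) = heptagon_triple (\<xi> i)" using per[of i] by (simp add: \<xi>)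
    then have "heptagon_triple (\<xi> i) (\<xi> (i + 7))" "heptagon_triple (\<xi> (i + 7)) (\<xi> i)"
      by (metis heptagon_triple_def diff_self insertI1 mod_0)+
    moreover have "(\<xi> i - \<xi> (i + 7)) mod 7 = (0 - (\<xi> (i + 7) - \<xi> i) mod 7) mod 7"
      unfolding mod_diff_right_eq by simp
    ultimately have "(\<xi> (i + 7) - \<xi> i) mod 7 = 0"
      unfolding heptagon_triple_def by (cases "\<xi> (i + 7) - \<xi> i" rule: residue_7_cases) simp_all
    then show ?thesis by (simp only: mod_eq_0_iff_dvd)
  qed
  have e: "e i = 1 \<or> e i = -1" for i by (simp add: e_def)
  have e_Suc: "e (i + 1) = e i" for i
  proof -
    obtain q where q: "\<And>j. \<xi> (j + 1) = \<xi> j + e j + 7 * q j"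
    proof -
      have "\<exists>q. \<xi> (j + 1) = \<xi> j + e j + 7 * q" for j
        using step[of j] by (auto simp: dvd_def algebra_simps)
      then show ?thesis using that by metis
    qed
    obtain p where p: "\<xi> (i + 7) = \<xi> i + 7 * p"
      using wrap[of i] by (auto simp: dvd_def algebra_simps)
    \<comment> \<open>Coding the signs as bits turns their sum into \<open>2 * B - 7\<close>, so
      \<open>B\<close> is divisible by 7.\<close>
    define b where "b j = (e j + 1) div 2" for j
    have b: "e j = 2 * b j - 1" "0 \<le> b j" "b j \<le> 1" for j using e[of j] by (auto simp: b_def)
    define K where "K = p - (q i + q (i + 1) + q (i + 2) + q (i + 3) + q (i + 4) + q (i + 5) + q (i + 6))"
    have "e i + e (i + 1) + e (i + 2) + e (i + 3) + e (i + 4) + e (i + 5) + e (i + 6) = 7 * K"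
      using q[of i] q[of "i + 1"] q[of "i + 2"] q[of "i + 3"] q[of "i + 4"] q[of "i + 5"] q[of "i + 6"] p
      by (simp add: K_def add.assoc)
    then have "2 * (b i + b (i + 1) + b (i + 2) + b (i + 3) + b (i + 4) + b (i + 5) + b (i + 6)) = 7 * (K + 1)"
      by (simp add: b(1))
    moreover define B where "B = b i + b (i + 1) + b (i + 2) + b (i + 3) + b (i + 4) + b (i + 5) + b (i + 6)"
    ultimately have "2 * B = 7 * (K + 1)" by simp
    then have "7 dvd 2 * B" by simp
    then have "7 dvd B" by (simp add: coprime_dvd_mult_right_iff)
    then have "\<not> (0 < B \<and> B < 7)" by (auto dest: zdvd_imp_le)
    \<comment> \<open>Seven bits with a multiple of 7 as their sum are all equal, whereas two
      different bits keep \<open>B\<close> strictly between 0 and 7.\<close>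
    moreover have "0 < B \<and> B < 7" if "b i \<noteq> b (i + 1)"
      using that b(2,3)[of i] b(2,3)[of "i + 1"] b(2,3)[of "i + 2"] b(2,3)[of "i + 3"] b(2,3)[of "i + 4"]
        b(2,3)[of "i + 5"] b(2,3)[of "i + 6"] unfolding B_def by linarith
    ultimately have "b i = b (i + 1)" by blast
    then show ?thesis by (simp add: b(1))
  qed
  have e_const: "e i = e 0" for i
    by (induction i rule: int_induct[of _ 0]) (use e_Suc in \<open>metis diff_add_cancel\<close>)+
  have "7 dvd \<xi> i - (e 0 * i + \<xi> 0)" for i
  proof (induction i rule: int_induct[of _ 0])
    case base
    show ?case by simp
  next
    case (step1 i)
    have eq: "\<xi> (i + 1) - (e 0 * (i + 1) + \<xi> 0) = (\<xi> i - (e 0 * i + \<xi> 0)) + (\<xi> (i + 1) - \<xi> i - e i)"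
      by (simp add: e_const[of i] algebra_simps)
    show ?case unfolding eq using step1(2) step by (rule dvd_add)
  next
    case (step2 i)
    have eq: "\<xi> (i - 1) - (e 0 * (i - 1) + \<xi> 0) = (\<xi> i - (e 0 * i + \<xi> 0)) - (\<xi> i - \<xi> (i - 1) - e (i - 1))"
      by (simp add: e_const[of "i - 1"] algebra_simps)
    show ?case unfolding eq using dvd_diff[OF step2(2) step[of "i - 1"]] by simp
  qed
  then have "X i = heptagon_triple (e 0 * i + \<xi> 0)" for i
    unfolding \<xi> by (rule heptagon_triple_cong)
  then show ?thesis using that e by blast
qed

text \<open>Bounds the total over three mutually adjacent fibres. If no hub is selected, their rim
  sets are disjoint in one period. If one is, its own rim set is empty and the other two hold at
  most \<open>t\<close> vertices each.\<close>

lemma wheel_triangle_count: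
  assumes n: "n = 2 * int t + 1"
    and ind: "wheel_independent n a P" "wheel_independent n b Q" "wheel_independent n c T"
    and hub: "\<not> (a \<and> b)" "\<not> (a \<and> c)" "\<not> (b \<and> c)"
    and disj: "\<And>i. P i \<Longrightarrow> \<not> Q i" "\<And>i. P i \<Longrightarrow> \<not> T i" "\<And>i. Q i \<Longrightarrow> \<not> T i"
  shows "count_below n P + count_below n Q + count_below n T + of_bool a + of_bool b + of_bool c \<le> n"
proof (cases "a \<or> b \<or> c")
  case True
  have "count_below n P \<le> int t * (1 - of_bool a)" "count_below n Q \<le> int t * (1 - of_bool b)"
    "count_below n T \<le> int t * (1 - of_bool c)"
    using ind[unfolded n, THEN count_below_independent] unfolding n .
  with True hub show ?thesis using n by auto
next
  case False
  have "count_below n P + count_below n Q + count_below n T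
      = (\<Sum>i\<in>{0..<n}. of_bool (P i) + of_bool (Q i) + of_bool (T i))"
    by (simp add: count_below_def sum.distrib)
  also have "\<dots> \<le> of_nat (card {0..<n}) * 1"
    using disj by (intro sum_bounded_above) (auto simp: of_bool_def)
  finally show ?thesis using False n by simp
qed

text \<open>The remaining candidates are \<open>g \<plusminus> 1\<close> and the adjacent pair \<open>g + 3\<close>, \<open>g + 4\<close>.\<close>

lemma heptagon_triple_forced:
  assumes ind: "wheel_independent 7 h P" and card: "count_below 7 P = 3"
    and "\<not> P g" "\<not> P (g + 2)" "\<not> P (g - 2)"
  shows "P (g + 1)" "P (g - 1)"
proof -
  note per = wheel_independentD(1)[OF ind]
  have "P (g + 5) = P (g - 2)" "P (g + 6) = P (g - 1)"
    using per[of "g - 2"] per[of "g - 1"] by (simp_all add: add.commute)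
  moreover have "\<not> (P (g + 3) \<and> P (g + 4))"
    using wheel_independentD(2)[OF ind, of "g + 3"] by (auto simp: add.assoc)
  ultimately show "P (g + 1)" "P (g - 1)"
    using count_below_7[of P g, OF per] card assms(3-5) by (auto simp: of_bool_def split: if_splits)
qed

text \<open>
  The rows outside \<open>{x, x + 2, x + 4}\<close> are two isolated vertices \<open>x + 1\<close>, \<open>x + 3\<close> and the edge
  between \<open>x + 5\<close> and \<open>x + 6\<close>, and similarly for the columns. Their product splits into four
  isolated vertices, four edges and a 4-cycle, so ten independent vertices use all of these fully.
\<close>

lemma wheel_square_triple_cells:
  assumes ind: "wheel_square_independent 7 h (heptagon_triple x) (heptagon_triple y) M"
    and card: "(\<Sum>r\<in>{0..<7}. count_below 7 (M r)) = 10"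
  shows "M (x + 1) (y + 1)" "M (x + 1) (y + 3)" "M (x + 3) (y + 1)" "M (x + 3) (y + 3)"
    and "M (x + 5) (y + 5) \<and> M (x + 6) (y + 6) \<or> M (x + 5) (y + 6) \<and> M (x + 6) (y + 5)"
proof -
  have row: "wheel_independent 7 (heptagon_triple x r) (M r)"
    and col: "wheel_independent 7 (heptagon_triple y c) (\<lambda>r. M r c)" for r c
    using ind by (auto simp: wheel_square_independent_def)
  have empty: "\<not> M (x + d) c" "\<not> M r (y + d)" if "d \<in> {0, 2, 4}" for d r c
    using wheel_independentD(3)[OF row, of "x + d" c] wheel_independentD(3)[OF col, of "y + d" r] that
    by (auto simp: heptagon_triple_def)
  define b where "b i j = (of_bool (M (x + i) (y + j)) :: int)" for i j
  have b: "0 \<le> b i j" "b i j \<le> 1" for i j by (simp_all add: b_def)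
  have adj: "b i j + b i (j + 1) \<le> 1" "b i j + b (i + 1) j \<le> 1" for i j
    using wheel_independentD(2)[OF row[of "x + i"], of "y + j"]
      wheel_independentD(2)[OF col[of "y + j"], of "x + i"]
    by (auto simp: b_def add.assoc)
  have cnt: "count_below 7 (M (x + i)) = b i 1 + b i 3 + b i 5 + b i 6" for i
    using count_below_7[of "M (x + i)" y, OF wheel_independentD(1)[OF row]] empty(2)[of 0] empty(2)[of 2] empty(2)[of 4]
    by (simp add: b_def)
  have "(\<Sum>r\<in>{0..<7}. count_below 7 (M r)) = (\<Sum>r\<in>{x..<x + 7}. count_below 7 (M r))"
  proof (rule sum_periodic_shift[symmetric])
    have "M (r + 7) c = M r c" for r c by (rule wheel_independentD(1)[OF col])
    then show "count_below 7 (M (r + 7)) = count_below 7 (M r)" for r by (simp add: count_below_def)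
  qed
  also have "\<dots> = count_below 7 (M (x + 1)) + count_below 7 (M (x + 3))
      + count_below 7 (M (x + 5)) + count_below 7 (M (x + 6))"
    using empty(1)[of 0] empty(1)[of 2] empty(1)[of 4] cnt[of 0] cnt[of 2] cnt[of 4]
    by (simp add: atLeastLessThan_7 b_def)
  finally have "b 1 1 + b 1 3 + b 1 5 + b 1 6 + (b 3 1 + b 3 3 + b 3 5 + b 3 6)
      + (b 5 1 + b 5 3 + b 5 5 + b 5 6) + (b 6 1 + b 6 3 + b 6 5 + b 6 6) = 10"
    using card by (simp add: cnt)
  moreover have "b 1 5 + b 1 6 \<le> 1" "b 3 5 + b 3 6 \<le> 1" "b 5 1 + b 6 1 \<le> 1" "b 5 3 + b 6 3 \<le> 1"
    "b 5 5 + b 5 6 \<le> 1" "b 6 5 + b 6 6 \<le> 1" "b 5 5 + b 6 5 \<le> 1" "b 5 6 + b 6 6 \<le> 1"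
    using adj(1)[of 1 5] adj(1)[of 3 5] adj(2)[of 5 1] adj(2)[of 5 3] adj(1)[of 5 5] adj(1)[of 6 5]
      adj(2)[of 5 5] adj(2)[of 5 6] by simp_all
  ultimately have "b 1 1 = 1" "b 1 3 = 1" "b 3 1 = 1" "b 3 3 = 1" "b 5 5 = b 6 6" "b 5 6 = b 6 5" "b 5 5 + b 5 6 = 1"
    using b(2)[of 1 1] b(2)[of 1 3] b(2)[of 3 1] b(2)[of 3 3] by linarith+
  then show "M (x + 1) (y + 1)" "M (x + 1) (y + 3)" "M (x + 3) (y + 1)" "M (x + 3) (y + 3)"
    and "M (x + 5) (y + 5) \<and> M (x + 6) (y + 6) \<or> M (x + 5) (y + 6) \<and> M (x + 6) (y + 5)"
    by (auto simp: b_def of_bool_def split: if_splits)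
qed

text \<open>\<open>Q k\<close> is a rim fibre and \<open>M\<close> the hub fibre. The isolated cells
  of \<open>Q k\<close> and \<open>Q (k - 2)\<close> force two vertices in each row of
  \<open>M\<close>. One of these blocks a cell of the 4-cycle in a rim fibre, so all rim fibres
  choose the same diagonal, and then two adjacent ones share a cell.\<close>

lemma no_rotating_triples:
  fixes Q :: "int \<Rightarrow> int \<Rightarrow> int \<Rightarrow> bool"
  assumes \<sigma>: "\<sigma> = 1 \<or> \<sigma> = -1"
    and cells: "\<And>k. Q k (k + x + 1) (\<sigma> * k + y + 1)" "\<And>k. Q k (k + x + 1) (\<sigma> * k + y + 3)"
      "\<And>k. Q k (k + x + 3) (\<sigma> * k + y + 1)" "\<And>k. Q k (k + x + 3) (\<sigma> * k + y + 3)"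
      "\<And>k. Q k (k + x + 5) (\<sigma> * k + y + 5) \<and> Q k (k + x + 6) (\<sigma> * k + y + 6)
        \<or> Q k (k + x + 5) (\<sigma> * k + y + 6) \<and> Q k (k + x + 6) (\<sigma> * k + y + 5)"
    and adj: "\<And>k r c. Q k r c \<Longrightarrow> \<not> Q (k + 1) r c"
    and hub: "\<And>k r c. M r c \<Longrightarrow> \<not> Q k r c"
    and rows: "\<And>r. wheel_independent 7 (R r) (M r)" "\<And>r. count_below 7 (M r) = 3"
  shows False
proof -
  \<comment> \<open>The middle one of the three columns \<open>g k - 2\<close>, \<open>g k\<close>,
    \<open>g k + 2\<close> that are excluded from row \<open>k + x + 1\<close> of
    \<open>M\<close>.\<close>
  define g where "g k = \<sigma> * k + y + 2 - \<sigma>" for k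
  have forced: "M (k + x + 1) (g k + 1)" "M (k + x + 1) (g k - 1)" for k
  proof -
    have "\<not> M (k + x + 1) (\<sigma> * k + y + 1)" "\<not> M (k + x + 1) (\<sigma> * k + y + 3)"
      using cells(1,2)[of k] hub by blast+
    \<comment> \<open>Row \<open>k + x + 1\<close> is row \<open>(k - 2) + x + 3\<close> of the
      fibre \<open>Q (k - 2)\<close>.\<close>
    moreover have "\<not> M (k + x + 1) (\<sigma> * (k - 2) + y + 1)" "\<not> M (k + x + 1) (\<sigma> * (k - 2) + y + 3)"
      using cells(3,4)[of "k - 2"] hub[of "k + x + 1" _ "k - 2"] by (auto simp: algebra_simps)
    ultimately have "\<not> M (k + x + 1) (g k)" "\<not> M (k + x + 1) (g k + 2)" "\<not> M (k + x + 1) (g k - 2)"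
      using \<sigma> by (auto simp: g_def algebra_simps)
    then show "M (k + x + 1) (g k + 1)" "M (k + x + 1) (g k - 1)"
      using heptagon_triple_forced[OF rows] by blast+
  qed
  have per: "M r (c + 7) = M r c" for r c using rows(1) by (rule wheel_independentD(1))
  show False
  proof (cases "\<sigma> = 1")
    case True
    \<comment> \<open>The shift by 5 moves the forced row \<open>k + x + 1\<close> to row
      \<open>k + x + 6\<close> of the 4-cycle.\<close>
    have "M (k + x + 6) (k + y + 5)" for k
      using forced(2)[of "k + 5"] True by (simp add: g_def algebra_simps)
    then have "\<not> Q k (k + x + 6) (k + y + 5)" for k using hub by blast
    then have "Q k (k + x + 5) (k + y + 5)" "Q k (k + x + 6) (k + y + 6)" for k
      using cells(5)[of k] True by auto
    \<comment> \<open>Both facts concern the cell \<open>(x + 6, y + 6)\<close>, in the adjacent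
      fibres \<open>Q 1\<close> and \<open>Q 0\<close>.\<close>
    from this(1)[of 1] this(2)[of 0] adj[of 0] show False by (simp add: algebra_simps)
  next
    case False
    then have \<sigma>: "\<sigma> = -1" using \<sigma> by simp
    have "M (k + x + 6) (- k + y + 6)" for k
      using forced(1)[of "k + 5"] per[of "k + x + 6" "- k + y - 1"] \<sigma> by (simp add: g_def algebra_simps)
    then have "\<not> Q k (k + x + 6) (- k + y + 6)" for k using hub by blast
    then have "Q k (k + x + 5) (- k + y + 6)" "Q k (k + x + 6) (- k + y + 5)" for k
      using cells(5)[of k] \<sigma> by auto
    from this(1)[of 1] this(2)[of 0] adj[of 0] show False by (simp add: algebra_simps)
  qed
qed

text \<open>The equality case for \<open>t = 3\<close>; the weight 44 then determines the number of
  (rim, rim) vertices of each type.\<close>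

lemma wheel_square_extremal:
  assumes ind: "wheel_square_independent 7 h R C M"
    and weight: "2 * of_bool h + 4 * (count_below 7 C + count_below 7 R)
      + 2 * (\<Sum>r\<in>{0..<7}. count_below 7 (M r)) = 44"
  shows "h \<and> count_below 7 C = 0 \<and> count_below 7 R = 0 \<and> (\<Sum>r\<in>{0..<7}. count_below 7 (M r)) = 21 \<or>
    \<not> h \<and> count_below 7 C = 1 \<and> count_below 7 R = 1 \<and> (\<Sum>r\<in>{0..<7}. count_below 7 (M r)) = 18 \<or>
    \<not> h \<and> count_below 7 C = 3 \<and> count_below 7 R = 3 \<and> (\<Sum>r\<in>{0..<7}. count_below 7 (M r)) = 10"
  using wheel_square_weight(2)[OF ind, of 3] weight by auto

text \<open>
  In each triangle of the third wheel exactly two of the three fibres are of the type with three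
  vertices in the hub row. Around the odd rim this forces all rim fibres to be of this type, so their
  hub rows and hub columns rotate.
\<close>

lemma no_extremal_wheel_cube:
  assumes ind0: "wheel_square_independent 7 h0 R0 C0 M0"
    and ind: "\<And>i. wheel_square_independent 7 (h i) (R i) (C i) (M i)"
    and third: "wheel_independent 7 h0 h" "\<And>r. wheel_independent 7 (R0 r) (\<lambda>i. R i r)"
      "\<And>c. wheel_independent 7 (C0 c) (\<lambda>i. C i c)" "\<And>r c. wheel_independent 7 (M0 r c) (\<lambda>i. M i r c)"
    and weight0: "2 * of_bool h0 + 4 * (count_below 7 C0 + count_below 7 R0)
      + 2 * (\<Sum>r\<in>{0..<7}. count_below 7 (M0 r)) = 44"
    and weight: "\<And>i. 2 * of_bool (h i) + 4 * (count_below 7 (C i) + count_below 7 (R i))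
      + 2 * (\<Sum>r\<in>{0..<7}. count_below 7 (M i r)) = 44"
  shows False
proof -
  note type0 = wheel_square_extremal[OF ind0 weight0] and type = wheel_square_extremal[OF ind weight]
  let ?mhub = "\<Sum>r\<in>{0..<7}. count_below 7 (M0 r)" and ?m = "\<lambda>i. \<Sum>r\<in>{0..<7}. count_below 7 (M i r)"
  note h3 = wheel_independentD[OF third(1)] and R3 = wheel_independentD[OF third(2)]
    and C3 = wheel_independentD[OF third(3)] and M3 = wheel_independentD[OF third(4)]
  have rows: "?mhub + ?m i + ?m (i + 1) + count_below 7 R0 + count_below 7 (R i) + count_below 7 (R (i + 1)) \<le> 49" for i
  proof -
    have "(\<Sum>r\<in>{0..<7}. count_below 7 (M0 r) + count_below 7 (M i r) + count_below 7 (M (i + 1) r)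
        + of_bool (R0 r) + of_bool (R i r) + of_bool (R (i + 1) r)) \<le> (\<Sum>r\<in>{0..<7 :: int}. 7)"
    proof (intro sum_mono wheel_triangle_count[where t = 3])
      fix r
      show "wheel_independent 7 (R0 r) (M0 r)" using ind0 by (simp add: wheel_square_independent_def)
      show "wheel_independent 7 (R i r) (M i r)" "wheel_independent 7 (R (i + 1) r) (M (i + 1) r)"
        using ind by (simp_all add: wheel_square_independent_def)
    qed (simp, (use R3 M3 in blast)+)
    then show ?thesis by (simp add: sum.distrib) (simp add: count_below_def)
  qed
  have hub_row: "count_below 7 C0 + count_below 7 (C i) + count_below 7 (C (i + 1))
      + of_bool h0 + of_bool (h i) + of_bool (h (i + 1)) \<le> 7" for i
  proof (rule wheel_triangle_count[where t = 3])
    show "wheel_independent 7 h0 C0" using ind0 by (simp add: wheel_square_independent_def)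
    show "wheel_independent 7 (h i) (C i)" "wheel_independent 7 (h (i + 1)) (C (i + 1))"
      using ind by (simp_all add: wheel_square_independent_def)
  qed (simp, (use h3 C3 in blast)+)
  have R_per: "R (i + 7) = R i" and C_per: "C (i + 7) = C i" for i
    using R3(1) C3(1) by (auto intro: ext)
  define T where "T i \<longleftrightarrow> count_below 7 (C i) = 3" for i
  have hub_excl: "\<not> (h0 \<and> h i)" "\<not> (h i \<and> h (i + 1))" for i using h3 by blast+
  \<comment> \<open>In the order of the three types, a fibre contributes 21, 19 or 13 to
    \<open>rows\<close> and 1, 1 or 3 to \<open>hub_row\<close>. The limit 49 permits at most one
    fibre outside the last type, and the limit 7 at most two fibres of it.\<close>
  have two: "if count_below 7 C0 = 3 then T i \<longleftrightarrow> \<not> T (i + 1) else T i \<and> T (i + 1)" for i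
    using type0 type[of i] type[of "i + 1"] rows[of i] hub_row[of i] hub_excl(1)[of i] hub_excl(1)[of "i + 1"]
      hub_excl(2)[of i]
    unfolding T_def by (elim disjE) auto
  \<comment> \<open>Otherwise \<open>T\<close> would alternate around a rim of odd length.\<close>
  have "count_below 7 C0 \<noteq> 3"
  proof
    assume "count_below 7 C0 = 3"
    then have "T (i + 1) \<longleftrightarrow> \<not> T i" for i using two[of i] by auto
    from this[of 0] this[of 1] this[of 2] this[of 3] this[of 4] this[of 5] this[of 6]
    have "T 7 \<longleftrightarrow> \<not> T 0" by simp
    moreover have "C 7 = C 0" using C_per[of 0] by simp
    ultimately show False by (simp add: T_def)
  qed
  then have T: "count_below 7 (C i) = 3" for i using two[of i] by (simp add: T_def)
  have type: "\<not> h i" "count_below 7 (R i) = 3" "?m i = 10" for i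
    using type[of i] T[of i] by auto
  have sides: "wheel_independent 7 (h i) (R i)" "wheel_independent 7 (h i) (C i)" for i
    using ind by (simp_all add: wheel_square_independent_def)
  obtain \<delta> x where \<delta>: "\<delta> = 1 \<or> \<delta> = -1" and R: "\<And>i. R i = heptagon_triple (\<delta> * i + x)"
    by (rule heptagon_triples_rotate[of R h]) (use R_per R3(2) sides type in auto)
  obtain \<epsilon> y where \<epsilon>: "\<epsilon> = 1 \<or> \<epsilon> = -1" and C: "\<And>i. C i = heptagon_triple (\<epsilon> * i + y)"
    by (rule heptagon_triples_rotate[of C h]) (use C_per C3(2) sides T in auto)
  \<comment> \<open>The rotating triples reach every column, so the hub fibre can select none; this
    leaves it only the type with 21 grid vertices.\<close>
  have "\<not> C0 c" for c
  proof -
    have "\<epsilon> * (\<epsilon> * (c - y)) + y = c" using \<epsilon> by auto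
    then have "C (\<epsilon> * (c - y)) c" by (simp add: C heptagon_triple_def)
    then show ?thesis using C3(3) by blast
  qed
  then have "count_below 7 C0 = 0" by (simp add: count_below_def)
  then have m0: "?mhub = 21" using type0 by auto
  have row0: "wheel_independent 7 (R0 r) (M0 r)" for r
    using ind0 by (simp add: wheel_square_independent_def)
  have row_le: "count_below 7 (M0 r) \<le> 3" for r
    using count_below_independent[of 3 "R0 r" "M0 r"] row0[of r]
    by (simp add: of_bool_def split: if_splits)
  \<comment> \<open>Seven rows with at most three vertices each reach 21 only if every row has
    exactly three.\<close>
  have row_eq: "count_below 7 (M0 r) = 3" for r
  proof -
    have M0_per: "M0 (r + 7) = M0 r" for r
      using ind0 by (auto simp: wheel_square_independent_def wheel_independent_def)
    have "(\<Sum>r\<in>{0..<7 :: int}. 3 - count_below 7 (M0 r)) = 0"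
      using m0 by (simp add: sum_subtractf)
    then have "\<forall>r\<in>{0..<7}. 3 - count_below 7 (M0 r) = 0"
      using row_le by (subst (asm) sum_nonneg_eq_0_iff) auto
    then have "count_below 7 (M0 (r mod 7)) = 3" by simp
    then show ?thesis using periodic_mod[of M0 7 r] M0_per by simp
  qed
  \<comment> \<open>Traversing the rim in direction \<delta> makes the triples in \<open>R\<close>
    advance by +1, while those in \<open>C\<close> advance by
    \<open>\<epsilon> * \<delta>\<close>.\<close>
  define Q where "Q k = M (\<delta> * k)" for k
  have sq: "wheel_square_independent 7 (h (\<delta> * k)) (heptagon_triple (k + x))
      (heptagon_triple (\<epsilon> * \<delta> * k + y)) (Q k)" for k
  proof -
    have "\<delta> * (\<delta> * k) = k" using \<delta> by auto
    then show ?thesis using ind[of "\<delta> * k"] unfolding R C Q_def by (simp only: mult.assoc)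
  qed
  have "(\<Sum>r\<in>{0..<7}. count_below 7 (Q k r)) = 10" for k by (simp add: Q_def type(3))
  note cells = wheel_square_triple_cells[OF sq this]
  have "\<not> Q (k + 1) r c" if "Q k r c" for k r c
    using that \<delta> wheel_independentD(2)[OF third(4)[of r c], of "\<delta> * k"]
      wheel_independentD(2)[OF third(4)[of r c], of "\<delta> * k - 1"] by (auto simp: Q_def)
  moreover have "\<not> Q k r c" if "M0 r c" for k r c
    using M3(3)[OF that] by (simp add: Q_def)
  moreover have "\<epsilon> * \<delta> = 1 \<or> \<epsilon> * \<delta> = -1" using \<delta> \<epsilon> by auto
  ultimately show False
    using no_rotating_triples[of "\<epsilon> * \<delta>" Q x y M0 R0] cells row0 row_eq by blast
qed

subsection \<open>Weighted bounds for wheels\<close>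

abbreviation wheel_hub :: "nat + unit" where
  "wheel_hub \<equiv> Inr ()"

text \<open>All integers index the rim, so wrapping around becomes periodicity.\<close>

definition wheel_rim :: "nat \<Rightarrow> int \<Rightarrow> nat + unit" where
  "wheel_rim n i = Inl (nat (i mod int n))"

lemma pverts_wheel: "pverts (wheel n) = insert wheel_hub (Inl ` {..<n})"
  by (auto simp: wheel_def graph_join_def cycle_graph_def single_vertex_def)

lemma wheel_rim_in_wheel: "n > 0 \<Longrightarrow> wheel_rim n i \<in> pverts (wheel n)"
  by (auto simp: pverts_wheel wheel_rim_def nat_less_iff)

lemma sum_pverts_wheel:
  "sum f (pverts (wheel n)) = f wheel_hub + (\<Sum>i\<in>{0..<int n}. f (wheel_rim n i))"
proof -
  have "(\<Sum>i\<in>{0..<int n}. f (wheel_rim n i)) = sum f (Inl ` {..<n})"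
    by (rule sum.reindex_bij_witness[where i = "\<lambda>v. int (projl v)" and j = "wheel_rim n"])
      (auto simp: wheel_rim_def nat_less_iff)
  then show ?thesis by (simp add: pverts_wheel image_iff)
qed

lemma wheel_rim_arc:
  assumes "n > 0"
  shows "(wheel_rim n i, wheel_rim n (i + 1)) \<in> parcs (wheel n)"
proof -
  have "nat ((i + 1) mod int n) = Suc (nat (i mod int n)) mod n"
  proof -
    have "int (Suc (nat (i mod int n)) mod n) = (i mod int n + 1) mod int n"
      using assms by (simp add: zmod_int add.commute)
    also have "\<dots> = (i + 1) mod int n" by (rule mod_add_left_eq)
    finally show ?thesis by (metis nat_int)
  qed
  then show ?thesis
    using assms by (auto simp: wheel_def graph_join_def cycle_graph_def wheel_rim_def nat_less_iff)
qed

lemma wheel_hub_arc: "n > 0 \<Longrightarrow> (wheel_hub, wheel_rim n i) \<in> parcs (wheel n)"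
  by (auto simp: wheel_def graph_join_def cycle_graph_def single_vertex_def wheel_rim_def nat_less_iff)

lemma wheel_trace:
  assumes "n > 0" and "\<And>u v. (u, v) \<in> parcs (wheel n) \<Longrightarrow> P u \<Longrightarrow> \<not> P v"
  shows "wheel_independent (int n) (P wheel_hub) (\<lambda>i. P (wheel_rim n i))"
  unfolding wheel_independent_def
  using assms(2)[OF wheel_rim_arc[OF assms(1)]] assms(2)[OF wheel_hub_arc[OF assms(1)]]
  by (auto simp: wheel_rim_def)

lemma sum_pverts_cart_power_Suc:
  "sum f (pverts (cart_power G (Suc k))) = (\<Sum>xs\<in>pverts (cart_power G k). \<Sum>v\<in>pverts G. f (xs @ [v]))"
proof -
  have "sum f (pverts (cart_power G (Suc k)))
      = sum (f \<circ> (\<lambda>(vs, v). vs @ [v])) (pverts (cart_power G k) \<times> pverts G)"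
    unfolding cart_power.simps relabel_def cart_prod_def pair_pre_digraph.simps
    by (rule sum.reindex) (rule inj_on_subset[OF inj_snoc subset_UNIV])
  then show ?thesis by (simp add: sum.cartesian_product comp_def case_prod_beta del: cart_power.simps)
qed

text \<open>With \<open>t + 1\<close> on the mixed vertices, the three extremal types of
  \<open>wheel_square_weight\<close> share the same maximal weight.\<close>

definition wheel_square_coeff :: "nat \<Rightarrow> nat + unit \<Rightarrow> nat + unit \<Rightarrow> int" where
  "wheel_square_coeff t u v =
     (if (u = wheel_hub) = (v = wheel_hub) then 2 else int t + 1)"

lemma sum_wheel_square_coeff:
  "(\<Sum>u\<in>pverts (wheel n). \<Sum>v\<in>pverts (wheel n). of_bool (s u v) * wheel_square_coeff t u v)
    = 2 * of_bool (s wheel_hub wheel_hub)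
      + (int t + 1) * (count_below (int n) (\<lambda>c. s wheel_hub (wheel_rim n c))
        + count_below (int n) (\<lambda>r. s (wheel_rim n r) wheel_hub))
      + 2 * (\<Sum>r\<in>{0..<int n}. count_below (int n) (\<lambda>c. s (wheel_rim n r) (wheel_rim n c)))"
proof -
  have "wheel_rim n i \<noteq> wheel_hub" for i by (simp add: wheel_rim_def)
  then show ?thesis
    by (simp add: sum_pverts_wheel wheel_square_coeff_def count_below_def sum.distrib
        flip: sum_distrib_right sum_distrib_left) (simp add: algebra_simps)
qed

lemma total_wheel_square_coeff:
  "(\<Sum>u\<in>pverts (wheel n). \<Sum>v\<in>pverts (wheel n). wheel_square_coeff t u v)
    = 2 + 2 * (int t + 1) * int n + 2 * int n ^ 2"
  using sum_wheel_square_coeff[where s = "\<lambda>_ _. True" and n = n and t = t]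
  by (simp add: count_below_def power2_eq_square)

lemma wheel_square_trace:
  assumes n: "n > 0"
    and row: "\<And>u u' v. (u, u') \<in> parcs (wheel n) \<Longrightarrow> v \<in> pverts (wheel n) \<Longrightarrow> s u v \<Longrightarrow> \<not> s u' v"
    and col: "\<And>u v v'. (v, v') \<in> parcs (wheel n) \<Longrightarrow> u \<in> pverts (wheel n) \<Longrightarrow> s u v \<Longrightarrow> \<not> s u v'"
  shows "wheel_square_independent (int n) (s wheel_hub wheel_hub)
    (\<lambda>r. s (wheel_rim n r) wheel_hub) (\<lambda>c. s wheel_hub (wheel_rim n c))
    (\<lambda>r c. s (wheel_rim n r) (wheel_rim n c))"
proof -
  have hub: "wheel_hub \<in> pverts (wheel n)" by (simp add: pverts_wheel)
  note rim = wheel_rim_in_wheel[OF n]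
  show ?thesis
    unfolding wheel_square_independent_def
    using wheel_trace[OF n, of "\<lambda>u. s u wheel_hub"] wheel_trace[OF n, of "\<lambda>v. s wheel_hub v"]
      wheel_trace[OF n, of "\<lambda>v. s (wheel_rim n _) v"] wheel_trace[OF n, of "\<lambda>u. s u (wheel_rim n _)"]
      row[OF _ hub] row[OF _ rim] col[OF _ hub] col[OF _ rim]
    by auto
qed

text \<open>Stated for a predicate on pairs so that it serves both the square and the fibres of the
  cube.\<close>

lemma wheel_square_coeff_bound:
  assumes t: "t \<ge> 2"
    and row: "\<And>u u' v. (u, u') \<in> parcs (wheel (2 * t + 1)) \<Longrightarrow> v \<in> pverts (wheel (2 * t + 1)) \<Longrightarrow> s u v \<Longrightarrow> \<not> s u' v"
    and col: "\<And>u v v'. (v, v') \<in> parcs (wheel (2 * t + 1)) \<Longrightarrow> u \<in> pverts (wheel (2 * t + 1)) \<Longrightarrow> s u v \<Longrightarrow> \<not> s u v'"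
  shows "(\<Sum>u\<in>pverts (wheel (2 * t + 1)). \<Sum>v\<in>pverts (wheel (2 * t + 1)).
      of_bool (s u v) * wheel_square_coeff t u v) \<le> 4 * int t ^ 2 + 2 * int t + 2"
proof -
  have "wheel_square_independent (int (2 * t + 1)) (s wheel_hub wheel_hub)
    (\<lambda>r. s (wheel_rim (2 * t + 1) r) wheel_hub) (\<lambda>c. s wheel_hub (wheel_rim (2 * t + 1) c))
    (\<lambda>r c. s (wheel_rim (2 * t + 1) r) (wheel_rim (2 * t + 1) c))"
    by (rule wheel_square_trace[OF _ row col]) auto
  from wheel_square_weight(1)[OF this _ t]
  have "(\<Sum>u\<in>pverts (wheel (2 * t + 1)). \<Sum>v\<in>pverts (wheel (2 * t + 1)).
      of_bool (s u v) * wheel_square_coeff t u v) \<le> 2 * int t * int (2 * t + 1) + 2"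
    unfolding sum_wheel_square_coeff by simp
  then show ?thesis by (simp add: power2_eq_square algebra_simps)
qed

lemma sum_independent_set:
  fixes w :: "'a \<Rightarrow> int"
  assumes "independent_set G S" "finite (pverts G)"
  shows "sum w S = (\<Sum>x\<in>pverts G. of_bool (x \<in> S) * w x)"
  using assms by (intro sum.mono_neutral_cong_left) (auto simp: independent_set_def)

section \<open>Ratio bounds from the square and the cube\<close>

lemma ultimate_independence_ratio_wheel_le:
  assumes t: "t \<ge> 2"
  shows "ultimate_independence_ratio (wheel (2 * t + 1)) * (12 * real t ^ 2 + 14 * real t + 6)
    \<le> 4 * real t ^ 2 + 2 * real t + 2"
proof -
  let ?W = "wheel (2 * t + 1)"
  define w where "w xs = wheel_square_coeff t (xs ! 0) (xs ! 1)" for xs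
  have W: "pair_graph ?W" using t by (intro pair_graph_wheel) simp
  have fin: "finite (pverts (cart_power ?W 2))"
    using W pair_graph_cart_power pair_graphD(1) by blast
  have split: "sum f (pverts (cart_power ?W 2)) = (\<Sum>u\<in>pverts ?W. \<Sum>v\<in>pverts ?W. f [u, v])" for f :: "_ \<Rightarrow> int"
    unfolding numeral_2_eq_2 sum_pverts_cart_power_Suc by (simp add: single_vertex_def)
  have "ultimate_independence_ratio ?W * (\<Sum>xs\<in>pverts (cart_power ?W 2). real_of_int (w xs))
      \<le> real_of_int (4 * int t ^ 2 + 2 * int t + 2)"
  proof (rule ultimate_independence_ratio_le_weighted[OF W])
    show "pverts ?W \<noteq> {}" by (simp add: pverts_wheel)
    show "0 \<le> real_of_int (w xs)" for xs by (simp add: w_def wheel_square_coeff_def)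
    fix S assume S: "independent_set (cart_power ?W 2) S"
    have not_both: "xs \<in> S \<Longrightarrow> (xs, ys) \<in> parcs (cart_power ?W 2) \<Longrightarrow> ys \<notin> S" for xs ys
      using S by (auto simp: independent_set_def)
    have "sum w S = (\<Sum>xs\<in>pverts (cart_power ?W 2). of_bool (xs \<in> S) * w xs)"
      using S fin by (rule sum_independent_set)
    also have "\<dots> = (\<Sum>u\<in>pverts ?W. \<Sum>v\<in>pverts ?W. of_bool ([u, v] \<in> S) * wheel_square_coeff t u v)"
      unfolding split w_def by simp
    also have "\<dots> \<le> 4 * int t ^ 2 + 2 * int t + 2"
    proof (rule wheel_square_coeff_bound[OF t])
      show "[u', v] \<notin> S" if "(u, u') \<in> parcs ?W" "v \<in> pverts ?W" "[u, v] \<in> S" for u u' v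
        using not_both[OF that(3)] parcs_cart_powerI[of u u' ?W "[]" "[v]"] that by (simp add: numeral_2_eq_2 del: cart_power.simps)
      show "[u, v'] \<notin> S" if "(v, v') \<in> parcs ?W" "u \<in> pverts ?W" "[u, v] \<in> S" for u v v'
        using not_both[OF that(3)] parcs_cart_powerI[of v v' ?W "[u]" "[]"] that by (simp add: numeral_2_eq_2 del: cart_power.simps)
    qed
    finally show "(\<Sum>xs\<in>S. real_of_int (w xs)) \<le> real_of_int (4 * int t ^ 2 + 2 * int t + 2)"
      by (metis of_int_le_iff of_int_sum)
  qed
  moreover have "(\<Sum>xs\<in>pverts (cart_power ?W 2). w xs) = 12 * int t ^ 2 + 14 * int t + 6"
    unfolding split w_def using total_wheel_square_coeff[where n = "2 * t + 1" and t = t]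
    by (simp add: power2_eq_square algebra_simps)
  ultimately show ?thesis by (simp flip: of_int_sum)
qed

lemma ultimate_independence_ratio_wheel_7_le: "ultimate_independence_ratio (wheel 7) \<le> 9 / 32"
proof -
  let ?W = "wheel 7" and ?hub = wheel_hub and ?rim = "wheel_rim 7"
  define w where "w xs = wheel_square_coeff 3 (xs ! 0) (xs ! 1)" for xs
  have W: "pair_graph ?W" by (intro pair_graph_wheel) simp
  have fin: "finite (pverts (cart_power ?W 3))"
    using W pair_graph_cart_power pair_graphD(1) by blast
  \<comment> \<open>The third coordinate becomes the outermost sum, so that the inner sums are
    weights of fibres.\<close>
  have split: "sum f (pverts (cart_power ?W 3))
      = (\<Sum>z\<in>pverts ?W. \<Sum>u\<in>pverts ?W. \<Sum>v\<in>pverts ?W. f [u, v, z])" for f :: "_ \<Rightarrow> int"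
  proof -
    have "sum f (pverts (cart_power ?W 3)) = (\<Sum>u\<in>pverts ?W. \<Sum>v\<in>pverts ?W. \<Sum>z\<in>pverts ?W. f [u, v, z])"
      unfolding numeral_3_eq_3 sum_pverts_cart_power_Suc by (simp add: single_vertex_def)
    also have "\<dots> = (\<Sum>u\<in>pverts ?W. \<Sum>z\<in>pverts ?W. \<Sum>v\<in>pverts ?W. f [u, v, z])"
      by (intro sum.cong refl sum.swap)
    also have "\<dots> = (\<Sum>z\<in>pverts ?W. \<Sum>u\<in>pverts ?W. \<Sum>v\<in>pverts ?W. f [u, v, z])"
      by (rule sum.swap)
    finally show ?thesis .
  qed
  have "ultimate_independence_ratio ?W * (\<Sum>xs\<in>pverts (cart_power ?W 3). real_of_int (w xs)) \<le> real_of_int 351"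
  proof (rule ultimate_independence_ratio_le_weighted[OF W])
    show "pverts ?W \<noteq> {}" by (simp add: pverts_wheel)
    show "0 \<le> real_of_int (w xs)" for xs by (simp add: w_def wheel_square_coeff_def)
    fix S assume S: "independent_set (cart_power ?W 3) S"
    have not_both: "xs \<in> S \<Longrightarrow> (xs, ys) \<in> parcs (cart_power ?W 3) \<Longrightarrow> ys \<notin> S" for xs ys
      using S by (auto simp: independent_set_def)
    have arc1: "[u', v, z] \<notin> S"
      if "(u, u') \<in> parcs ?W" "v \<in> pverts ?W" "z \<in> pverts ?W" "[u, v, z] \<in> S" for u u' v z
      using not_both[OF that(4)] parcs_cart_powerI[of u u' ?W "[]" "[v, z]"] that
      by (simp add: numeral_3_eq_3 del: cart_power.simps)
    have arc2: "[u, v', z] \<notin> S"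
      if "(v, v') \<in> parcs ?W" "u \<in> pverts ?W" "z \<in> pverts ?W" "[u, v, z] \<in> S" for u v v' z
      using not_both[OF that(4)] parcs_cart_powerI[of v v' ?W "[u]" "[z]"] that
      by (simp add: numeral_3_eq_3 del: cart_power.simps)
    have arc3: "[u, v, z'] \<notin> S"
      if "(z, z') \<in> parcs ?W" "u \<in> pverts ?W" "v \<in> pverts ?W" "[u, v, z] \<in> S" for u v z z'
      using not_both[OF that(4)] parcs_cart_powerI[of z z' ?W "[u, v]" "[]"] that
      by (simp add: numeral_3_eq_3 del: cart_power.simps)
    define \<Phi> where "\<Phi> z = (\<Sum>u\<in>pverts ?W. \<Sum>v\<in>pverts ?W.
      of_bool ([u, v, z] \<in> S) * wheel_square_coeff 3 u v)" for z
    have \<Phi>_le: "\<Phi> z \<le> 44" if "z \<in> pverts ?W" for z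
      using wheel_square_coeff_bound[of 3 "\<lambda>u v. [u, v, z] \<in> S"] arc1 arc2 that by (simp add: \<Phi>_def)
    have "\<exists>z\<in>pverts ?W. \<Phi> z \<noteq> 44"
    proof (rule ccontr)
      assume "\<not> (\<exists>z\<in>pverts ?W. \<Phi> z \<noteq> 44)"
      then have \<Phi>: "\<Phi> z = 44" if "z \<in> pverts ?W" for z using that by blast
      have hub: "?hub \<in> pverts ?W" by (simp add: pverts_wheel)
      have rim: "?rim i \<in> pverts ?W" for i by (rule wheel_rim_in_wheel) simp
      have sq: "wheel_square_independent 7 ([?hub, ?hub, z] \<in> S) (\<lambda>r. [?rim r, ?hub, z] \<in> S)
          (\<lambda>c. [?hub, ?rim c, z] \<in> S) (\<lambda>r c. [?rim r, ?rim c, z] \<in> S)" if "z \<in> pverts ?W" for z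
        using wheel_square_trace[of 7 "\<lambda>u v. [u, v, z] \<in> S"] arc1 arc2 that by simp
      have third: "wheel_independent 7 ([u, v, ?hub] \<in> S) (\<lambda>i. [u, v, ?rim i] \<in> S)"
        if "u \<in> pverts ?W" "v \<in> pverts ?W" for u v
        using wheel_trace[of 7 "\<lambda>z. [u, v, z] \<in> S"] arc3 that by simp
      have weight: "2 * of_bool ([?hub, ?hub, z] \<in> S)
          + 4 * (count_below 7 (\<lambda>c. [?hub, ?rim c, z] \<in> S) + count_below 7 (\<lambda>r. [?rim r, ?hub, z] \<in> S))
          + 2 * (\<Sum>r\<in>{0..<7}. count_below 7 (\<lambda>c. [?rim r, ?rim c, z] \<in> S)) = 44"
        if "z \<in> pverts ?W" for z
        using \<Phi>[OF that] sum_wheel_square_coeff[where n = 7 and t = 3 and s = "\<lambda>u v. [u, v, z] \<in> S"] by (simp add: \<Phi>_def)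
      show False
        by (rule no_extremal_wheel_cube[OF sq[OF hub] sq[OF rim] third[OF hub hub] third[OF rim hub]
              third[OF hub rim] third[OF rim rim] weight[OF hub] weight[OF rim]])
    qed
    \<comment> \<open>Integrality gives one fibre at most 43, so the total is at most 43 + 7 * 44 =
      351.\<close>
    then obtain z where z: "z \<in> pverts ?W" "\<Phi> z \<le> 43" using \<Phi>_le by force
    have finW: "finite (pverts ?W)" by (simp add: pverts_wheel)
    have "sum w S = (\<Sum>xs\<in>pverts (cart_power ?W 3). of_bool (xs \<in> S) * w xs)"
      using S fin by (rule sum_independent_set)
    also have "\<dots> = sum \<Phi> (pverts ?W)" unfolding split w_def \<Phi>_def by simp
    also have "\<dots> = \<Phi> z + sum \<Phi> (pverts ?W - {z})" using finW z(1) by (rule sum.remove)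
    also have "sum \<Phi> (pverts ?W - {z}) \<le> of_nat (card (pverts ?W - {z})) * 44"
      using \<Phi>_le by (intro sum_bounded_above) auto
    also have "card (pverts ?W - {z}) = 7" using z(1) finW card_wheel[of 7] by simp
    finally show "(\<Sum>xs\<in>S. real_of_int (w xs)) \<le> real_of_int 351"
      using z(2) unfolding of_int_sum[symmetric] of_int_le_iff by simp
  qed
  moreover have "(\<Sum>xs\<in>pverts (cart_power ?W 3). w xs) = 1248"
    unfolding split w_def using total_wheel_square_coeff[where n = 7 and t = 3] card_wheel[of 7] by simp
  ultimately show ?thesis by (simp flip: of_int_sum)
qed

theorem theorem1p5:
  fixes t :: nat
  assumes "t \<ge> 3"
  shows "ultimate_independence_ratio (wheel (2 * t + 1))
    \<le> (4 * real t ^ 2 + 6 * real t) / (3 * (2 * real t + 2) ^ 2)"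
proof (cases "t = 3")
  case True
  \<comment> \<open>For \<open>t = 3\<close> the claimed bound is 54/192 = 9/32.\<close>
  then show ?thesis using ultimate_independence_ratio_wheel_7_le by simp
next
  case False
  \<comment> \<open>Expanded around \<open>t = 4\<close>, the cross-multiplied difference has only
    positive coefficients.\<close>
  define x where "x = real t - 4"
  have x: "x \<ge> 0" "real t = x + 4" using assms False by (auto simp: x_def)
  have pos: "12 * real t ^ 2 + 14 * real t + 6 > 0" by (simp add: add_nonneg_pos)
  have "ultimate_independence_ratio (wheel (2 * t + 1))
      \<le> (4 * real t ^ 2 + 2 * real t + 2) / (12 * real t ^ 2 + 14 * real t + 6)"
    using ultimate_independence_ratio_wheel_le[of t] assms pos by (simp add: pos_le_divide_eq)
  also have "\<dots> \<le> (4 * real t ^ 2 + 6 * real t) / (3 * (2 * real t + 2) ^ 2)"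
  proof -
    have "(4 * real t ^ 2 + 6 * real t) * (12 * real t ^ 2 + 14 * real t + 6)
        - (4 * real t ^ 2 + 2 * real t + 2) * (3 * (2 * real t + 2) ^ 2)
      = 4 * (2 * x ^ 3 + 21 * x ^ 2 + 63 * x + 38)"
      unfolding x(2) by (simp add: power2_eq_square power3_eq_cube algebra_simps)
    also have "\<dots> \<ge> 0" using x(1) by simp
    finally show ?thesis using pos by (simp add: divide_le_eq pos_le_divide_eq frac_le_eq)
  qed
  finally show ?thesis .
qed

end
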